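(* Consider a goal-augmented Markov decision process with maximum reward $R_{\max}$ and discount factor $\gamma$, a training distribution $P_X^{\mathcal{S}}$ and a testing distribution $P_X^{\mathcal{T}}$ of state-goal pairs, and an expert policy $\pi_E$ that is the same across the training and testing domains. Consider a finite hypothesis space $\Pi$ of policies, and suppose the empirical loss function $\hat\varepsilon^{\mathcal{S}}$ is minimized with $m$ samples. For a policy $\pi$ and a surrogate expert policy $\hat\pi_E$, with probability at least $1-\delta$, the following bound holds: $$\mathrm{SubOpt}(\pi_E,\pi)\le \frac{2R_{\max}}{(1-\gamma)^2}\left[\hat\varepsilon^{\mathcal{S}}(\hat\pi_E,\pi)+\varepsilon^{\mathcal{S}}(\hat\pi_E,\pi_E)+d_1(\mathcal{T},\mathcal{S})+\sqrt{\frac{\log 2|\Pi|+\log\frac1\delta}{2m}}\right].$$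
   Context: A goal-augmented Markov decision process is a tuple $(\mathcal{S},\mathcal{A},\mathcal{G},\mathcal{P},r,\gamma)$ with state space $\mathcal{S}$, action space $\mathcal{A}$, goal space $\mathcal{G}$, transition distribution $\mathcal{P}(\cdot\mid s,a)$, goal-conditioned reward function $r(s,a,g)\in\mathbb{R}$ and discount factor $\gamma$; $R_{\max}$ denotes the maximum reward. A policy $\pi$ gives a distribution $\pi(\cdot\mid s,g)$ on actions for each state $s$ and goal $g$. Its value function is $$V^\pi(s,g)=\mathbb{E}_{a_t\sim\pi(\cdot\mid s_t,g),\ s_{t+1}\sim\mathcal{P}(\cdot\mid s_t,a_t)}\Big[\sum_{t=0}^\infty\gamma^t r(s_t,a_t,g)\,\Big|\,s_0=s\Big].$$ Let $\mathcal{X}=\mathcal{S}\times\mathcal{G}$ be the input space. $P_X^{\mathcal{S}}$ and $P_X^{\mathcal{T}}$ are the training and testing distributions on $\mathcal{X}$ (as a superscript or as an argument of $d_1$, $\mathcal{S}$ is a label for the training distribution, not the state space; $\mathcal{T}$ labels the testing distribution). The suboptimality on the testing domain is $$\mathrm{SubOpt}(\pi_E,\pi)=\mathbb{E}_{(s_0,g)\sim P_X^{\mathcal{T}}}\big[V^{\pi_E}(s_0,g)-V^{\pi}(s_0,g)\big].$$ The true expert policy $\pi_E$ is generally not accessible; a surrogate policy $\hat\pi_E$ is imitated instead. The total variation distance between two policies is $D_{\mathrm{TV}}(\pi_1(\cdot\mid s,g),\pi_2(\cdot\mid s,g))=\sup_{B\subset\mathcal{A}}\big|\int_{a\in B}(\pi_1(a\mid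 s,g)-\pi_2(a\mid s,g))\big|$, where $B$ is any measurable subset of $\mathcal{A}$. The discounted state occupancy is $d_\pi(s\mid s_0,g)=(1-\gamma)\sum_{t=0}^\infty\gamma^t\Pr(s_t=s\mid\pi,s_0,g)$. The policy discrepancy on a state-goal distribution labelled $\rho$ is $$\varepsilon^\rho(\pi_1,\pi_2)=\mathbb{E}_{(s_0,g)\sim P_X^\rho,\ s\sim d_{\pi_E}(s\mid s_0,g)}\big[D_{\mathrm{TV}}(\pi_1(\cdot\mid s,g),\pi_2(\cdot\mid s,g))\big],$$ and $\hat\varepsilon^{\mathcal{S}}(\hat\pi_E,\pi)$ (the empirical imitation loss) is the empirical version of $\varepsilon^{\mathcal{S}}(\hat\pi_E,\pi)$, i.e. the expectation replaced by the average over $m$ samples. The variation divergence between two distributions $S_1,S_2$ on $\mathcal{X}$ with densities $P_{S_1},P_{S_2}$ is $d_1(S_1,S_2)=2\sup_{\mathcal{J}\subset\mathcal{X}}\big|\int_{x\in\mathcal{J}}(P_{S_1}(x)-P_{S_2}(x))\,dx\big|$, where $\mathcal{J}$ is any measurable subset of $\mathcal{X}$; $d_1(\mathcal{T},\mathcal{S})$ is this quantity for the testing and training distributions.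
   Formalization: The maximum reward is taken as the supremum of the absolute reward, since the bound fails for negative rewards if it is the signed maximum; the action space is assumed to have a countably generated sigma-algebra so that the expected total variation distances are well defined. *)

theory Defs
  imports "HOL-Probability.Probability"
begin

text \<open>
  A goal-augmented Markov decision process. The three spaces are arbitrary measurable spaces
  (only \<open>space\<close> and \<open>sets\<close> of the measures \<open>states\<close>, \<open>actions\<close>, \<open>goals\<close> are used), so that
  finite, countable and continuous spaces are all covered.
\<close>

record ('s, 'a, 'g) gamdp =
  states :: "'s measure"
  actions :: "'a measure"
  goals :: "'g measure"
  trans :: "'s \<Rightarrow> 'a \<Rightarrow> 's measure"
  reward :: "'s \<Rightarrow> 'a \<Rightarrow> 'g \<Rightarrow> real"
  discount :: real

type_synonym ('s, 'a, 'g) policy = "'s \<Rightarrow> 'g \<Rightarrow> 'a measure"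

abbreviation inputs :: "('s, 'a, 'g) gamdp \<Rightarrow> ('s \<times> 'g) measure" where
  "inputs M \<equiv> states M \<Otimes>\<^sub>M goals M"

definition countably_generated :: "'a measure \<Rightarrow> bool" where
  "countably_generated A \<longleftrightarrow>
     (\<exists>E. countable E \<and> E \<subseteq> Pow (space A) \<and> sets A = sigma_sets (space A) E)"

text \<open>
  Countable generation of the action space makes
  \<open>(s, g) \<mapsto> D\<^sub>T\<^sub>V(\<pi>\<^sub>1(\<cdot>|s,g), \<pi>\<^sub>2(\<cdot>|s,g))\<close>, a supremum over all measurable sets, a measurable
  function; otherwise the expectations of it need not exist. Every countable discrete space and
  every Borel space of a second-countable topology satisfies it.
\<close>

definition is_gamdp :: "('s, 'a, 'g) gamdp \<Rightarrow> bool" where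
  "is_gamdp M \<longleftrightarrow>
     countably_generated (actions M) \<and>
     (\<lambda>(s, a). trans M s a) \<in> states M \<Otimes>\<^sub>M actions M \<rightarrow>\<^sub>M prob_algebra (states M) \<and>
     (\<lambda>(s, a, g). reward M s a g) \<in> borel_measurable (states M \<Otimes>\<^sub>M actions M \<Otimes>\<^sub>M goals M) \<and>
     bdd_above ((\<lambda>(s, a, g). \<bar>reward M s a g\<bar>) ` (space (states M) \<times> space (actions M) \<times> space (goals M))) \<and>
     0 \<le> discount M \<and> discount M < 1"

text \<open>Rewards may be negative, so the maximum reward is taken in absolute value.\<close>

definition R_max :: "('s, 'a, 'g) gamdp \<Rightarrow> real" where
  "R_max M = (SUP (s, a, g) \<in> space (states M) \<times> space (actions M) \<times> space (goals M). \<bar>reward M s a g\<bar>)"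

definition is_policy :: "('s, 'a, 'g) gamdp \<Rightarrow> ('s, 'a, 'g) policy \<Rightarrow> bool" where
  "is_policy M \<pi> \<longleftrightarrow> (\<lambda>(s, g). \<pi> s g) \<in> inputs M \<rightarrow>\<^sub>M prob_algebra (actions M)"

text \<open>
  The law of the trajectory \<open>(s\<^sub>t, a\<^sub>t)\<^sub>t\<close> is the infinite-horizon measure of the
  Ionescu-Tulcea theorem for the step kernels below; \<open>\<omega> j\<close> is the pair \<open>(s\<^sub>j, a\<^sub>j)\<close>.
\<close>

definition step_kernel ::
  "('s, 'a, 'g) gamdp \<Rightarrow> ('s, 'a, 'g) policy \<Rightarrow> 's \<Rightarrow> 'g \<Rightarrow> nat \<Rightarrow> (nat \<Rightarrow> 's \<times> 'a) \<Rightarrow> ('s \<times> 'a) measure"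
where
  "step_kernel M \<pi> s\<^sub>0 g t \<omega> = do {
     s \<leftarrow> (case t of 0 \<Rightarrow> return (states M) s\<^sub>0 | Suc j \<Rightarrow> trans M (fst (\<omega> j)) (snd (\<omega> j)));
     a \<leftarrow> \<pi> s g;
     return (states M \<Otimes>\<^sub>M actions M) (s, a)
   }"

definition trajectory ::
  "('s, 'a, 'g) gamdp \<Rightarrow> ('s, 'a, 'g) policy \<Rightarrow> 's \<Rightarrow> 'g \<Rightarrow> (nat \<Rightarrow> 's \<times> 'a) measure"
where
  "trajectory M \<pi> s\<^sub>0 g =
     projective_family.lim UNIV
       (Ionescu_Tulcea.CI (step_kernel M \<pi> s\<^sub>0 g) (\<lambda>_. states M \<Otimes>\<^sub>M actions M))
       (\<lambda>_. states M \<Otimes>\<^sub>M actions M)"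

definition V :: "('s, 'a, 'g) gamdp \<Rightarrow> ('s, 'a, 'g) policy \<Rightarrow> 's \<Rightarrow> 'g \<Rightarrow> real" where
  "V M \<pi> s g = (\<integral>\<omega>. (\<Sum>t. discount M ^ t * reward M (fst (\<omega> t)) (snd (\<omega> t)) g) \<partial>trajectory M \<pi> s g)"

definition SubOpt ::
  "('s, 'a, 'g) gamdp \<Rightarrow> ('s \<times> 'g) measure \<Rightarrow> ('s, 'a, 'g) policy \<Rightarrow> ('s, 'a, 'g) policy \<Rightarrow> real"
where
  "SubOpt M PT \<pi>\<^sub>E \<pi> = (\<integral>(s\<^sub>0, g). V M \<pi>\<^sub>E s\<^sub>0 g - V M \<pi> s\<^sub>0 g \<partial>PT)"

definition occupancy ::
  "('s, 'a, 'g) gamdp \<Rightarrow> ('s, 'a, 'g) policy \<Rightarrow> 's \<Rightarrow> 'g \<Rightarrow> 's measure"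
where
  "occupancy M \<pi> s\<^sub>0 g =
     measure_of (space (states M)) (sets (states M))
       (\<lambda>B. ennreal ((1 - discount M) *
              (\<Sum>t. discount M ^ t * \<P>(\<omega> in trajectory M \<pi> s\<^sub>0 g. fst (\<omega> t) \<in> B))))"

definition sup_diff :: "'x measure \<Rightarrow> 'x measure \<Rightarrow> 'x measure \<Rightarrow> real" where
  "sup_diff X \<mu> \<nu> = (SUP B \<in> sets X. \<bar>measure \<mu> B - measure \<nu> B\<bar>)"

definition D_TV ::
  "('s, 'a, 'g) gamdp \<Rightarrow> ('s, 'a, 'g) policy \<Rightarrow> ('s, 'a, 'g) policy \<Rightarrow> 's \<Rightarrow> 'g \<Rightarrow> real"
where
  "D_TV M \<pi>\<^sub>1 \<pi>\<^sub>2 s g = sup_diff (actions M) (\<pi>\<^sub>1 s g) (\<pi>\<^sub>2 s g)"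

text \<open>
  Unlike the total variation distance above, the variation divergence carries the factor 2.
  Stated for arbitrary laws; densities are not needed.
\<close>

definition d1 :: "('s, 'a, 'g) gamdp \<Rightarrow> ('s \<times> 'g) measure \<Rightarrow> ('s \<times> 'g) measure \<Rightarrow> real" where
  "d1 M \<mu> \<nu> = 2 * sup_diff (inputs M) \<mu> \<nu>"

text \<open>
  The law of \<open>(s, g)\<close> when \<open>(s\<^sub>0, g) \<sim> \<rho>\<close> and then \<open>s \<sim> d\<^bsub>\<pi>\<^sub>E\<^esub>(\<cdot>|s\<^sub>0, g)\<close>. The policy
  discrepancy integrates over it, and the samples of the empirical loss are drawn from it.
\<close>

definition visit_dist ::
  "('s, 'a, 'g) gamdp \<Rightarrow> ('s, 'a, 'g) policy \<Rightarrow> ('s \<times> 'g) measure \<Rightarrow> ('s \<times> 'g) measure"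
where
  "visit_dist M \<pi>\<^sub>E \<rho> = do {
     (s\<^sub>0, g) \<leftarrow> \<rho>;
     s \<leftarrow> occupancy M \<pi>\<^sub>E s\<^sub>0 g;
     return (inputs M) (s, g)
   }"

definition discrepancy ::
  "('s, 'a, 'g) gamdp \<Rightarrow> ('s, 'a, 'g) policy \<Rightarrow> ('s \<times> 'g) measure \<Rightarrow>
   ('s, 'a, 'g) policy \<Rightarrow> ('s, 'a, 'g) policy \<Rightarrow> real"
where
  "discrepancy M \<pi>\<^sub>E \<rho> \<pi>\<^sub>1 \<pi>\<^sub>2 = (\<integral>(s, g). D_TV M \<pi>\<^sub>1 \<pi>\<^sub>2 s g \<partial>visit_dist M \<pi>\<^sub>E \<rho>)"

definition sample_space ::
  "('s, 'a, 'g) gamdp \<Rightarrow> ('s, 'a, 'g) policy \<Rightarrow> ('s \<times> 'g) measure \<Rightarrow> nat \<Rightarrow> (nat \<Rightarrow> 's \<times> 'g) measure"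
where
  "sample_space M \<pi>\<^sub>E \<rho> m = (\<Pi>\<^sub>M i\<in>{..<m}. visit_dist M \<pi>\<^sub>E \<rho>)"

definition emp_discrepancy ::
  "('s, 'a, 'g) gamdp \<Rightarrow> nat \<Rightarrow> (nat \<Rightarrow> 's \<times> 'g) \<Rightarrow>
   ('s, 'a, 'g) policy \<Rightarrow> ('s, 'a, 'g) policy \<Rightarrow> real"
where
  "emp_discrepancy M m z \<pi>\<^sub>1 \<pi>\<^sub>2 = (\<Sum>i<m. D_TV M \<pi>\<^sub>1 \<pi>\<^sub>2 (fst (z i)) (snd (z i))) / real m"

end

theory Submission
  imports Defs
begin

text \<open>
  At states visited by the expert, \<open>V\<^sup>\<pi>\<close> satisfies the Bellman equation of \<open>\<pi>\<^sub>E\<close> up to the error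
  of choosing one action by \<open>\<pi>\<^sub>E\<close> instead of \<open>\<pi>\<close>; since \<open>\<bar>Q\<^sup>\<pi>\<bar> \<le> R_max / (1 - \<gamma>)\<close>, that
  error is at most \<open>2 R_max / (1 - \<gamma>)\<close> times the total variation distance. Summing the discounted
  errors telescopes to the value gap and turns the state laws into the occupancy. The resulting
  function of the start pair takes values in \<open>[0, 1]\<close>, so moving from the testing to the training
  distribution costs at most their variation distance. The triangle inequality inserts the surrogate
  expert, and Hoeffding's inequality with a union bound replaces the expected by the empirical loss.
\<close>

text \<open>The two factors \<open>1 / (1 - \<gamma>)\<close> have different origins: one bounds the
  value function, the other undoes the normalization of the occupancy. The leading 2 appears because
  rewards may be negative: \<open>Q\<close> ranges over an interval symmetric about 0, whose length
  is twice the bound.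

  Measurability shapes much of the rest. \<open>D_TV\<close> is a supremum over possibly uncountably
  many events; countable generation of the action space reduces it to a supremum over a countable
  algebra. The occupancy is given as a set function, which has to be shown countably additive and
  measurable in the start pair; reading it as the law of the state at an independent geometric time
  settles both. The infinite-horizon law enters the estimates only through its one-time marginals,
  and these follow a simple recursion.\<close>

subsection \<open>Total variation\<close>

lemma (in prob_space) abs_measure_diff_le_1:
  assumes "prob_space N"
  shows "\<bar>measure M B - measure N B\<bar> \<le> 1"
proof -
  interpret N: prob_space N by fact
  show ?thesis
    using prob_le_1[of B] N.prob_le_1[of B] measure_nonneg[of M B] measure_nonneg[of N B]
    by linarith
qed

lemma bdd_above_sup_diff:
  assumes "prob_space \<mu>" "prob_space \<nu>"
  shows "bdd_above ((\<lambda>B. \<bar>measure \<mu> B - measure \<nu> B\<bar>) ` S)"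
  using prob_space.abs_measure_diff_le_1[OF assms] by (auto intro!: bdd_aboveI[where M=1])

lemma sup_diff_upper:
  assumes "prob_space \<mu>" "prob_space \<nu>" "B \<in> sets X"
  shows "\<bar>measure \<mu> B - measure \<nu> B\<bar> \<le> sup_diff X \<mu> \<nu>"
  unfolding sup_diff_def using bdd_above_sup_diff[OF assms(1,2)] assms(3) by (intro cSUP_upper)

lemma sup_diff_le:
  assumes "\<And>B. B \<in> sets X \<Longrightarrow> \<bar>measure \<mu> B - measure \<nu> B\<bar> \<le> c"
  shows "sup_diff X \<mu> \<nu> \<le> c"
  unfolding sup_diff_def using assms sets.empty_sets[of X] by (intro cSUP_least) auto

lemma sup_diff_le_1:
  assumes "prob_space \<mu>" "prob_space \<nu>"
  shows "sup_diff X \<mu> \<nu> \<le> 1"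
  by (intro sup_diff_le prob_space.abs_measure_diff_le_1 assms)

lemma sup_diff_nonneg:
  assumes "prob_space \<mu>" "prob_space \<nu>"
  shows "0 \<le> sup_diff X \<mu> \<nu>"
  using sup_diff_upper[OF assms sets.empty_sets, of X] by simp

lemma sup_diff_commute: "sup_diff X \<mu> \<nu> = sup_diff X \<nu> \<mu>"
  unfolding sup_diff_def by (simp add: abs_minus_commute)

lemma sup_diff_triangle:
  assumes "prob_space \<mu>" "prob_space \<nu>" "prob_space \<rho>"
  shows "sup_diff X \<mu> \<rho> \<le> sup_diff X \<mu> \<nu> + sup_diff X \<nu> \<rho>"
  using sup_diff_upper[OF assms(1,2)] sup_diff_upper[OF assms(2,3)]
  by (intro sup_diff_le) (smt (verit))

text \<open>The number \<open>f x - a\<close> is the length of the interval from \<open>a\<close> to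
  \<open>f x\<close>. Exchanging this length integral with the integral over \<open>x\<close> by
  Tonelli leaves the probabilities of superlevel sets.\<close>

lemma (in prob_space) nn_integral_layer_cake:
  fixes f :: "'a \<Rightarrow> real"
  assumes [measurable]: "f \<in> borel_measurable M"
    and f: "\<And>x. x \<in> space M \<Longrightarrow> f x \<in> {a..b}"
  shows "(\<integral>\<^sup>+x. ennreal (f x - a) \<partial>M) =
    (\<integral>\<^sup>+t. ennreal (measure M {x \<in> space M. t \<le> f x}) * indicator {a..b} t \<partial>lborel)"
proof -
  interpret pair_sigma_finite M lborel by standard
  have "(\<integral>\<^sup>+x. ennreal (f x - a) \<partial>M) = (\<integral>\<^sup>+x. \<integral>\<^sup>+t. indicator {a..f x} t \<partial>lborel \<partial>M)"
    using f by (intro nn_integral_cong) auto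
  \<comment> \<open>The interval depends on \<open>x\<close>; as a conditional on \<open>t\<close>
    and \<open>f x\<close> the integrand is visibly measurable in both variables jointly, which
    Tonelli requires.\<close>
  also have "\<dots> = (\<integral>\<^sup>+x. \<integral>\<^sup>+t. (if a \<le> t \<and> t \<le> f x then 1 else 0) \<partial>lborel \<partial>M)"
    by (intro nn_integral_cong) (auto split: split_indicator)
  also have "\<dots> = (\<integral>\<^sup>+t. \<integral>\<^sup>+x. (if a \<le> t \<and> t \<le> f x then 1 else 0) \<partial>M \<partial>lborel)"
    by (rule Fubini'[symmetric]) measurable
  also have "\<dots> = (\<integral>\<^sup>+t. \<integral>\<^sup>+x. indicator {x \<in> space M. t \<le> f x} x * indicator {a..b} t \<partial>M \<partial>lborel)"
    using f by (intro nn_integral_cong) (force split: split_indicator)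
  also have "\<dots> = (\<integral>\<^sup>+t. ennreal (measure M {x \<in> space M. t \<le> f x}) * indicator {a..b} t \<partial>lborel)"
    by (intro nn_integral_cong) (simp add: nn_integral_multc emeasure_eq_measure)
  finally show ?thesis .
qed

text \<open>Superlevel sets of \<open>f\<close> are events, so their probabilities differ by at most
  \<open>sup_diff\<close>; integrating this over the levels in \<open>{a..b}\<close> gives the
  factor \<open>b - a\<close>. Measuring \<open>f\<close> by its range and not by its absolute value
  matters: the bound serves once for a function with values in \<open>[-B, B]\<close> and once for
  one with values in \<open>[0, 1]\<close>.\<close>

lemma integral_diff_le_sup_diff:
  fixes f :: "'x \<Rightarrow> real"
  assumes \<mu>: "\<mu> \<in> space (prob_algebra X)" and \<nu>: "\<nu> \<in> space (prob_algebra X)"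
    and f[measurable]: "f \<in> borel_measurable X" and ab: "\<And>x. x \<in> space X \<Longrightarrow> f x \<in> {a..b}"
  shows "(\<integral>x. f x \<partial>\<mu>) - (\<integral>x. f x \<partial>\<nu>) \<le> (b - a) * sup_diff X \<mu> \<nu>"
proof -
  have sets[measurable_cong]: "sets \<mu> = sets X" "sets \<nu> = sets X"
    and prob: "prob_space \<mu>" "prob_space \<nu>"
    using \<mu> \<nu> by (auto simp: space_prob_algebra)
  interpret \<mu>: prob_space \<mu> by fact
  interpret \<nu>: prob_space \<nu> by fact
  have sp: "space \<mu> = space X" "space \<nu> = space X"
    using sets by (auto dest: sets_eq_imp_space_eq)
  have fm: "f \<in> borel_measurable \<mu>" "f \<in> borel_measurable \<nu>" by measurable
  obtain x0 where "x0 \<in> space X" using \<mu>.not_empty sp by auto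
  then have "a \<le> b" using ab[of x0] by auto
  have int: "integrable \<mu> f" "integrable \<nu> f"
    by (rule \<mu>.integrable_const_bound[where B="max \<bar>a\<bar> \<bar>b\<bar>"]
             \<nu>.integrable_const_bound[where B="max \<bar>a\<bar> \<bar>b\<bar>"];
        use ab sp fm in \<open>force intro!: AE_I2\<close>)+
  define T where "T = sup_diff X \<mu> \<nu>"
  have T: "0 \<le> T" unfolding T_def by (intro sup_diff_nonneg prob)
  have layer: "(\<integral>\<^sup>+x. ennreal (f x - a) \<partial>\<mu>) =
      (\<integral>\<^sup>+t. ennreal (measure \<mu> {x \<in> space \<mu>. t \<le> f x}) * indicator {a..b} t \<partial>lborel)"
    "(\<integral>\<^sup>+x. ennreal (f x - a) \<partial>\<nu>) =
      (\<integral>\<^sup>+t. ennreal (measure \<nu> {x \<in> space \<nu>. t \<le> f x}) * indicator {a..b} t \<partial>lborel)"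
    using \<mu>.nn_integral_layer_cake[OF fm(1), of a b] \<nu>.nn_integral_layer_cake[OF fm(2), of a b] ab sp
    by auto
  have "(\<integral>\<^sup>+x. ennreal (f x - a) \<partial>\<mu>) \<le>
    (\<integral>\<^sup>+t. (ennreal (measure \<nu> {x \<in> space \<nu>. t \<le> f x}) * indicator {a..b} t
      + ennreal T * indicator {a..b} t) \<partial>lborel)"
    unfolding layer(1)
  proof (intro nn_integral_mono)
    fix t :: real
    have "{x \<in> space X. t \<le> f x} \<in> sets X" by measurable
    from sup_diff_upper[OF prob this]
    have "measure \<mu> {x \<in> space X. t \<le> f x} \<le> measure \<nu> {x \<in> space X. t \<le> f x} + T"
      by (simp add: T_def)
    then have "ennreal (measure \<mu> {x \<in> space X. t \<le> f x}) \<le>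
      ennreal (measure \<nu> {x \<in> space X. t \<le> f x}) + ennreal T"
      by (simp add: T flip: ennreal_plus)
    then show "ennreal (measure \<mu> {x \<in> space \<mu>. t \<le> f x}) * indicator {a..b} t
      \<le> ennreal (measure \<nu> {x \<in> space \<nu>. t \<le> f x}) * indicator {a..b} t
        + ennreal T * indicator {a..b} t"
      by (simp add: sp split: split_indicator)
  qed
  also have "\<dots> = (\<integral>\<^sup>+x. ennreal (f x - a) \<partial>\<nu>) + ennreal T * ennreal (b - a)"
  proof (subst nn_integral_add)
    \<comment> \<open>Splitting the integral of the sum requires the tail probability to be
      measurable in the level \<open>t\<close>. Written as an integral over \<open>x\<close>, it is
      so by Tonelli.\<close>
    have *: "(\<lambda>t. \<integral>\<^sup>+x. (if t \<le> f x then 1 else 0) \<partial>\<nu>) \<in> borel_measurable lborel"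
      by measurable
    have **: "ennreal (measure \<nu> {x \<in> space \<nu>. t \<le> f x}) = (\<integral>\<^sup>+x. (if t \<le> f x then 1 else 0) \<partial>\<nu>)" for t
    proof -
      have "ennreal (measure \<nu> {x \<in> space \<nu>. t \<le> f x}) = (\<integral>\<^sup>+x. indicator {x \<in> space \<nu>. t \<le> f x} x \<partial>\<nu>)"
        by (simp add: \<nu>.emeasure_eq_measure)
      also have "\<dots> = (\<integral>\<^sup>+x. (if t \<le> f x then 1 else 0) \<partial>\<nu>)"
        by (intro nn_integral_cong) (auto split: split_indicator)
      finally show ?thesis .
    qed
    show "(\<lambda>t. ennreal (measure \<nu> {x \<in> space \<nu>. t \<le> f x}) * indicator {a..b} t) \<in> borel_measurable lborel"
      unfolding ** using * by measurable
  qed (use \<open>a \<le> b\<close> layer(2) in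
        \<open>auto simp: nn_integral_cmult_indicator\<close>)
  also have "(\<integral>\<^sup>+x. ennreal (f x - a) \<partial>\<mu>) = ennreal (\<integral>x. f x - a \<partial>\<mu>)"
    using int ab sp by (intro nn_integral_eq_integral) (auto intro!: AE_I2)
  also have "(\<integral>\<^sup>+x. ennreal (f x - a) \<partial>\<nu>) = ennreal (\<integral>x. f x - a \<partial>\<nu>)"
    using int ab sp by (intro nn_integral_eq_integral) (auto intro!: AE_I2)
  finally have "ennreal (\<integral>x. f x - a \<partial>\<mu>) \<le> ennreal (\<integral>x. f x - a \<partial>\<nu>) + ennreal (T * (b - a))"
    using T \<open>a \<le> b\<close> by (simp add: ennreal_mult)
  also have "\<dots> = ennreal ((\<integral>x. f x - a \<partial>\<nu>) + T * (b - a))"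
    using T \<open>a \<le> b\<close> ab sp by (subst ennreal_plus) (auto intro!: integral_nonneg_AE AE_I2)
  finally have "(\<integral>x. f x - a \<partial>\<mu>) \<le> (\<integral>x. f x - a \<partial>\<nu>) + T * (b - a)"
    using T \<open>a \<le> b\<close> ab sp by (subst (asm) ennreal_le_iff) (auto intro!: add_nonneg_nonneg integral_nonneg_AE AE_I2)
  then show ?thesis
    using int by (simp add: \<mu>.prob_space \<nu>.prob_space T_def mult.commute)
qed

section \<open>Measurability of the total variation distance\<close>

text \<open>
  Boolean expressions over countably many generators enumerate the generated algebra, which is
  therefore countable.
\<close>

datatype bool_expr = Gen nat | Compl bool_expr | Inter bool_expr bool_expr

instance bool_expr :: countable
  by countable_datatype

primrec bool_expr_set :: "'x set \<Rightarrow> (nat \<Rightarrow> 'x set) \<Rightarrow> bool_expr \<Rightarrow> 'x set" where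
  "bool_expr_set \<Omega> e (Gen n) = e n"
| "bool_expr_set \<Omega> e (Compl b) = \<Omega> - bool_expr_set \<Omega> e b"
| "bool_expr_set \<Omega> e (Inter b c) = bool_expr_set \<Omega> e b \<inter> bool_expr_set \<Omega> e c"

lemma algebra_bool_expr_set:
  assumes "\<And>n. e n \<subseteq> \<Omega>"
  shows "algebra \<Omega> (range (bool_expr_set \<Omega> e))"
  unfolding algebra_iff_Int
proof safe
  fix x b assume "x \<in> bool_expr_set \<Omega> e b"
  then show "x \<in> \<Omega>" using assms by (induction b) auto
next
  show "{} \<in> range (bool_expr_set \<Omega> e)"
    by (rule range_eqI[of _ _ "Inter (Gen 0) (Compl (Gen 0))"]) auto
next
  fix b show "\<Omega> - bool_expr_set \<Omega> e b \<in> range (bool_expr_set \<Omega> e)"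
    by (rule range_eqI[of _ _ "Compl b"]) simp
next
  fix b c show "bool_expr_set \<Omega> e b \<inter> bool_expr_set \<Omega> e c \<in> range (bool_expr_set \<Omega> e)"
    by (rule range_eqI[of _ _ "Inter b c"]) simp
qed

lemma countably_generatedE:
  assumes "countably_generated X"
  obtains \<A> where "countable \<A>" "algebra (space X) \<A>" "sets X = sigma_sets (space X) \<A>"
proof -
  obtain E where E: "countable E" "E \<subseteq> Pow (space X)" "sets X = sigma_sets (space X) E"
    using assms unfolding countably_generated_def by auto
  \<comment> \<open>Adding the empty set guarantees a nonempty set to enumerate even if
    \<open>E\<close> is empty, and the generated sigma-algebra stays the same.\<close>
  define e where "e = from_nat_into (insert {} E)"
  have e: "range e = insert {} E"
    unfolding e_def using E(1) by (intro range_from_nat_into) auto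
  then have "e n \<subseteq> space X" for n
    using E(2) by (metis PowD empty_subsetI insert_iff rangeI subset_iff)
  note alg = algebra_bool_expr_set[of e, OF this]
  have "bool_expr_set (space X) e b \<in> sets X" for b
  proof (induction b)
    case (Gen n)
    have "e n \<in> insert {} E" using e by auto
    then show ?case using E(3) by auto
  qed auto
  then have "sigma_sets (space X) (range (bool_expr_set (space X) e)) \<subseteq> sets X"
    by (intro sets.sigma_sets_subset) auto
  moreover have "sigma_sets (space X) E \<subseteq> sigma_sets (space X) (range (bool_expr_set (space X) e))"
  proof (rule sigma_sets_mono, safe intro!: sigma_sets.Basic)
    fix A assume "A \<in> E"
    then obtain n where "A = e n" using e by blast
    then have "A = bool_expr_set (space X) e (Gen n)" by simp
    then show "A \<in> range (bool_expr_set (space X) e)" by blast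
  qed
  ultimately show ?thesis
    using alg E(3) by (intro that[of "range (bool_expr_set (space X) e)"]) auto
qed

text \<open>Sets that can be approximated form a sigma-algebra: complements leave the symmetric
  difference unchanged, and a countable union is cut to finitely many members that are approximated
  one by one. One set \<open>A\<close> must serve all measures of the family at once, since total
  variation compares two measures on the same event.\<close>

lemma algebra_approximates_sigma_sets:
  fixes \<rho> :: "'i \<Rightarrow> 'x measure" and \<epsilon> :: real
  assumes alg: "algebra \<Omega> \<A>" and fin: "finite I" "\<And>i. i \<in> I \<Longrightarrow> finite_measure (\<rho> i)"
    and sets: "\<And>i. i \<in> I \<Longrightarrow> sets (\<rho> i) = sigma_sets \<Omega> \<A>"
    and B: "B \<in> sigma_sets \<Omega> \<A>" and "0 < \<epsilon>"
  shows "\<exists>A\<in>\<A>. \<forall>i\<in>I. measure (\<rho> i) (sym_diff B A) < \<epsilon>"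
  using B \<open>0 < \<epsilon>\<close>
proof (induction arbitrary: \<epsilon> rule: sigma_sets.induct)
  interpret algebra \<Omega> \<A> by fact
  case (Basic A)
  then show ?case by (intro bexI[of _ A]) auto
next
  interpret algebra \<Omega> \<A> by fact
  case Empty
  then show ?case by (intro bexI[of _ "{}"]) auto
next
  interpret algebra \<Omega> \<A> by fact
  case (Compl B)
  then obtain A where A: "A \<in> \<A>" "\<forall>i\<in>I. measure (\<rho> i) (sym_diff B A) < \<epsilon>" by blast
  have "B \<subseteq> \<Omega>" "A \<subseteq> \<Omega>"
    using Compl.hyps A(1) space_closed sigma_sets_into_sp[OF space_closed] by auto
  then have "sym_diff (\<Omega> - B) (\<Omega> - A) = sym_diff B A" by auto
  then show ?case using A by (intro bexI[of _ "\<Omega> - A"]) auto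
next
  interpret algebra \<Omega> \<A> by fact
  case (Union a)
  note a = Union.hyps
  \<comment> \<open>The tails of the union decrease to the empty set, so their measures tend to 0;
    finiteness of \<open>I\<close> permits one cut-off for all measures.\<close>
  have "\<exists>N. \<forall>n\<ge>N. \<forall>i\<in>I. measure (\<rho> i) ((\<Union>j. a j) - (\<Union>j<n. a j)) < \<epsilon> / 2"
  proof -
    have "\<forall>\<^sub>F n in sequentially. measure (\<rho> i) ((\<Union>j. a j) - (\<Union>j<n. a j)) < \<epsilon> / 2" if "i \<in> I" for i
    proof -
      interpret finite_measure "\<rho> i" using fin that by auto
      have "range (\<lambda>n. (\<Union>j. a j) - (\<Union>j<n. a j)) \<subseteq> sets (\<rho> i)"
      proof safe
        fix n
        have "a j \<in> sets (\<rho> i)" for j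
          using a sets[OF that] by auto
        then have "(\<Union>j. a j) \<in> sets (\<rho> i)" "(\<Union>j<n. a j) \<in> sets (\<rho> i)"
          by auto
        then show "(\<Union>j. a j) - (\<Union>j<n. a j) \<in> sets (\<rho> i)" by (rule sets.Diff)
      qed
      moreover have "decseq (\<lambda>n. (\<Union>j. a j) - (\<Union>j<n. a j))"
        by (auto simp: decseq_def intro: order.strict_trans2)
      ultimately have "(\<lambda>n. measure (\<rho> i) ((\<Union>j. a j) - (\<Union>j<n. a j)))
        \<longlonglongrightarrow> measure (\<rho> i) (\<Inter>n. (\<Union>j. a j) - (\<Union>j<n. a j))"
        by (rule finite_Lim_measure_decseq)
      moreover have "(\<Inter>n. (\<Union>j. a j) - (\<Union>j<n. a j)) = {}" by auto
      ultimately have "(\<lambda>n. measure (\<rho> i) ((\<Union>j. a j) - (\<Union>j<n. a j))) \<longlonglongrightarrow> 0"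
        by (simp only: measure_empty)
      then show ?thesis
        using Union.prems by (intro order_tendstoD(2)) auto
    qed
    then have "\<forall>\<^sub>F n in sequentially. \<forall>i\<in>I. measure (\<rho> i) ((\<Union>j. a j) - (\<Union>j<n. a j)) < \<epsilon> / 2"
      using fin(1) by (intro eventually_ball_finite) auto
    then show ?thesis by (simp add: eventually_sequentially)
  qed
  then obtain n where n: "\<And>i. i \<in> I \<Longrightarrow> measure (\<rho> i) ((\<Union>j. a j) - (\<Union>j<n. a j)) < \<epsilon> / 2" by blast
  \<comment> \<open>The \<open>n\<close> errors of this size add up to at most
    \<open>\<epsilon> / 2\<close>, the other half being spent on the tail. \<open>Suc n\<close>
    avoids a division by zero when \<open>n = 0\<close>.\<close>
  have "\<exists>A\<in>\<A>. \<forall>i\<in>I. measure (\<rho> i) (sym_diff (a j) A) < \<epsilon> / (2 * Suc n)" for j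
    using Union.prems by (intro Union.IH) auto
  then obtain A where A: "\<And>j. A j \<in> \<A>"
    "\<And>i j. i \<in> I \<Longrightarrow> measure (\<rho> i) (sym_diff (a j) (A j)) < \<epsilon> / (2 * Suc n)" by metis
  show ?case
  proof (intro bexI ballI)
    show "(\<Union>j<n. A j) \<in> \<A>" using A(1) by auto
    fix i assume i: "i \<in> I"
    interpret finite_measure "\<rho> i" using fin i by auto
    have m: "a j \<in> sets (\<rho> i)" "A j \<in> sets (\<rho> i)" for j using a A(1) sets[OF i] by auto
    have "measure (\<rho> i) (sym_diff (\<Union>j. a j) (\<Union>j<n. A j))
      \<le> measure (\<rho> i) (((\<Union>j. a j) - (\<Union>j<n. a j)) \<union> (\<Union>j<n. sym_diff (a j) (A j)))"
      using m by (intro finite_measure_mono) auto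
    also have "\<dots> \<le> measure (\<rho> i) ((\<Union>j. a j) - (\<Union>j<n. a j)) + measure (\<rho> i) (\<Union>j<n. sym_diff (a j) (A j))"
      using m by (intro measure_Un_le) auto
    also have "measure (\<rho> i) (\<Union>j<n. sym_diff (a j) (A j)) \<le> (\<Sum>j<n. measure (\<rho> i) (sym_diff (a j) (A j)))"
      using m by (intro measure_UNION_le) auto
    also have "\<dots> \<le> (\<Sum>j<n. \<epsilon> / (2 * Suc n))"
      using A(2)[OF i] by (intro sum_mono less_imp_le) auto
    also have "\<dots> \<le> \<epsilon> / 2" using Union.prems by (simp add: field_simps)
    finally show "measure (\<rho> i) (sym_diff (\<Union>j. a j) (\<Union>j<n. A j)) < \<epsilon>" using n[OF i] by linarith
  qed
qed

lemma (in finite_measure) abs_measure_diff_le_sym_diff: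
  assumes [measurable]: "A \<in> sets M" "B \<in> sets M"
  shows "\<bar>measure M A - measure M B\<bar> \<le> measure M (sym_diff A B)"
proof -
  have "measure M A \<le> measure M (B \<union> sym_diff A B)" "measure M B \<le> measure M (A \<union> sym_diff A B)"
    by (intro finite_measure_mono; auto)+
  moreover have "measure M (B \<union> sym_diff A B) \<le> measure M B + measure M (sym_diff A B)"
    "measure M (A \<union> sym_diff A B) \<le> measure M A + measure M (sym_diff A B)"
    by (intro measure_Un_le; auto)+
  ultimately show ?thesis by linarith
qed

text \<open>An event and its approximant from the algebra have nearly the same probability under
  both measures, so nothing is lost in the supremum. When the algebra is countable, measurability in
  a parameter becomes a matter of countably many functions.\<close>

lemma sup_diff_eq_SUP_algebra:
  assumes alg: "algebra (space X) \<A>" and X: "sets X = sigma_sets (space X) \<A>"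
    and \<mu>: "\<mu> \<in> space (prob_algebra X)" and \<nu>: "\<nu> \<in> space (prob_algebra X)"
  shows "sup_diff X \<mu> \<nu> = (SUP B\<in>\<A>. \<bar>measure \<mu> B - measure \<nu> B\<bar>)" (is "_ = ?S")
proof (rule antisym)
  interpret algebra "space X" \<A> by fact
  have sets: "sets \<mu> = sets X" "sets \<nu> = sets X" and prob: "prob_space \<mu>" "prob_space \<nu>"
    using \<mu> \<nu> by (auto simp: space_prob_algebra)
  interpret \<mu>: prob_space \<mu> by fact
  interpret \<nu>: prob_space \<nu> by fact
  have sub: "\<A> \<subseteq> sets X" using X by auto
  show "?S \<le> sup_diff X \<mu> \<nu>"
    using sub sup_diff_upper[OF prob] top by (intro cSUP_least) blast+
  show "sup_diff X \<mu> \<nu> \<le> ?S"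
  proof (rule sup_diff_le, rule field_le_epsilon)
    fix B and e :: real assume B: "B \<in> sets X" and e: "0 < e"
    \<comment> \<open>A family indexed by the two booleans, so that one approximant is close for
      \<open>\<mu>\<close> and \<open>\<nu>\<close> simultaneously.\<close>
    define \<rho> where "\<rho> = (\<lambda>b. if b then \<mu> else \<nu>)"
    have "\<exists>A\<in>\<A>. \<forall>i\<in>UNIV. measure (\<rho> i) (sym_diff B A) < e / 2"
      using B e sets X \<mu>.finite_measure_axioms \<nu>.finite_measure_axioms
      by (intro algebra_approximates_sigma_sets[OF alg]) (auto simp: \<rho>_def)
    then obtain A where A: "A \<in> \<A>" and
      *: "measure \<mu> (sym_diff B A) < e / 2" "measure \<nu> (sym_diff B A) < e / 2"
      unfolding \<rho>_def by (metis (full_types) UNIV_I)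
    have "A \<in> sets X" using A sub by auto
    then have "\<bar>measure \<mu> B - measure \<mu> A\<bar> < e / 2" "\<bar>measure \<nu> B - measure \<nu> A\<bar> < e / 2"
      using \<mu>.abs_measure_diff_le_sym_diff[of B A] \<nu>.abs_measure_diff_le_sym_diff[of B A] * B sets
      by auto
    moreover have "\<bar>measure \<mu> A - measure \<nu> A\<bar> \<le> ?S"
      using A by (intro cSUP_upper bdd_above_sup_diff prob)
    ultimately show "\<bar>measure \<mu> B - measure \<nu> B\<bar> \<le> ?S + e" by linarith
  qed
qed

lemma measurable_sup_diff:
  assumes "countably_generated X"
    and \<kappa>[measurable]: "\<kappa> \<in> Y \<rightarrow>\<^sub>M prob_algebra X" and \<kappa>'[measurable]: "\<kappa>' \<in> Y \<rightarrow>\<^sub>M prob_algebra X"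
  shows "(\<lambda>y. sup_diff X (\<kappa> y) (\<kappa>' y)) \<in> borel_measurable Y"
proof -
  obtain \<A> where \<A>: "countable \<A>" "algebra (space X) \<A>" "sets X = sigma_sets (space X) \<A>"
    using countably_generatedE[OF assms(1)] by blast
  interpret algebra "space X" \<A> by fact
  have [measurable]: "B \<in> sets X" if "B \<in> \<A>" for B using that \<A> by auto
  have "(\<lambda>y. SUP B\<in>\<A>. \<bar>measure (\<kappa> y) B - measure (\<kappa>' y) B\<bar>) \<in> borel_measurable Y"
  proof (rule borel_measurable_cSUP)
    show "bdd_above ((\<lambda>B. \<bar>measure (\<kappa> y) B - measure (\<kappa>' y) B\<bar>) ` \<A>)" if "y \<in> space Y" for y
      using measurable_space[OF \<kappa> that] measurable_space[OF \<kappa>' that]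
      by (intro bdd_above_sup_diff) (auto simp: space_prob_algebra)
    show "(\<lambda>y. \<bar>measure (\<kappa> y) B - measure (\<kappa>' y) B\<bar>) \<in> borel_measurable Y" if "B \<in> \<A>" for B
      using that by measurable
  qed (use \<A> in auto)
  then show ?thesis
    by (subst measurable_cong[OF sup_diff_eq_SUP_algebra[OF \<A>(2,3)]])
       (auto intro: measurable_space[OF \<kappa>] measurable_space[OF \<kappa>'])
qed

subsection \<open>State laws along trajectories\<close>

lemma measurable_Pair_right:
  assumes "f \<in> X \<Otimes>\<^sub>M Y \<rightarrow>\<^sub>M Z" "y \<in> space Y"
  shows "(\<lambda>x. f (x, y)) \<in> X \<rightarrow>\<^sub>M Z"
  using measurable_compose[OF measurable_Pair2'[OF assms(2), of X] assms(1)] .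

text \<open>The part of \<open>step_kernel\<close> that is the same at every time. It keeps the
  state next to the action because a trajectory records pairs.\<close>

definition decide_action :: "('s, 'a, 'g) gamdp \<Rightarrow> ('s, 'a, 'g) policy \<Rightarrow> 's \<Rightarrow> 'g \<Rightarrow> ('s \<times> 'a) measure" where
  "decide_action M \<pi> s g = do {a \<leftarrow> \<pi> s g; return (states M \<Otimes>\<^sub>M actions M) (s, a)}"

definition move :: "('s, 'a, 'g) gamdp \<Rightarrow> ('s, 'a, 'g) policy \<Rightarrow> 's \<Rightarrow> 'g \<Rightarrow> 's measure" where
  "move M \<pi> s g = do {a \<leftarrow> \<pi> s g; trans M s a}"

text \<open>A recursive description of the law of the state at time \<open>t\<close> that avoids the
  infinite product; \<open>distr_trajectory\<close> shows that it agrees with the marginal of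
  \<open>trajectory\<close>.\<close>

primrec state_law ::
  "('s, 'a, 'g) gamdp \<Rightarrow> ('s, 'a, 'g) policy \<Rightarrow> nat \<Rightarrow> 's \<Rightarrow> 'g \<Rightarrow> 's measure"
where
  "state_law M \<pi> 0 s g = return (states M) s"
| "state_law M \<pi> (Suc t) s g = do {s' \<leftarrow> state_law M \<pi> t s g; move M \<pi> s' g}"

section \<open>Composition of probability kernels and integration against it\<close>

lemma kernel_bind_assoc:
  assumes "\<mu> \<in> space (prob_algebra X)" "f \<in> X \<rightarrow>\<^sub>M prob_algebra Y" "h \<in> Y \<rightarrow>\<^sub>M prob_algebra Z"
  shows "(\<mu> \<bind> f) \<bind> h = \<mu> \<bind> (\<lambda>x. f x \<bind> h)"
proof -
  have "f \<in> \<mu> \<rightarrow>\<^sub>M subprob_algebra Y"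
    using assms by (simp add: space_prob_algebra measurable_prob_algebraD cong: measurable_cong_sets)
  then show ?thesis
    using assms(3) by (intro bind_assoc) (auto intro: measurable_prob_algebraD)
qed

lemma kernel_return_bind:
  assumes "f \<in> X \<rightarrow>\<^sub>M prob_algebra Y" "x \<in> space X"
  shows "return X x \<bind> f = f x"
  using assms by (intro bind_return measurable_prob_algebraD)

lemma bind_in_space_prob_algebra:
  assumes "\<mu> \<in> space (prob_algebra X)" "f \<in> X \<rightarrow>\<^sub>M prob_algebra Y"
  shows "\<mu> \<bind> f \<in> space (prob_algebra Y)"
  using sets_bind'[OF assms] prob_space_bind'[OF assms] by (simp add: space_prob_algebra)

lemma integrable_bounded_prob_algebra:
  fixes f :: "'x \<Rightarrow> real"
  assumes \<mu>: "\<mu> \<in> space (prob_algebra X)" and f: "f \<in> borel_measurable X"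
    and B: "\<And>x. x \<in> space X \<Longrightarrow> \<bar>f x\<bar> \<le> B"
  shows "integrable \<mu> f"
proof -
  interpret prob_space \<mu> using \<mu> by (simp add: space_prob_algebra)
  have "sets \<mu> = sets X" using \<mu> by (simp add: space_prob_algebra)
  then show ?thesis
    using f B by (intro integrable_const_bound[where B=B])
      (auto intro!: AE_I2 dest: sets_eq_imp_space_eq cong: measurable_cong_sets)
qed

lemma abs_integral_le_prob_algebra:
  fixes f :: "'x \<Rightarrow> real"
  assumes \<mu>: "\<mu> \<in> space (prob_algebra X)" and f: "f \<in> borel_measurable X"
    and B: "\<And>x. x \<in> space X \<Longrightarrow> \<bar>f x\<bar> \<le> B"
  shows "\<bar>\<integral>x. f x \<partial>\<mu>\<bar> \<le> B"
proof -
  interpret prob_space \<mu> using \<mu> by (simp add: space_prob_algebra)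
  have sp: "space \<mu> = space X" using \<mu> by (auto simp: space_prob_algebra dest: sets_eq_imp_space_eq)
  have i: "integrable \<mu> f" by (rule integrable_bounded_prob_algebra[OF assms])
  have "\<bar>\<integral>x. f x \<partial>\<mu>\<bar> \<le> (\<integral>x. \<bar>f x\<bar> \<partial>\<mu>)" by (rule integral_abs_bound)
  also have "\<dots> \<le> (\<integral>x. B \<partial>\<mu>)" using i B sp by (intro integral_mono) auto
  finally show ?thesis by (simp add: prob_space)
qed

text \<open>For nonnegative functions this is the rule for \<open>nn_integral\<close> under bind. A
  signed function is raised by its bound \<open>B\<close> to become nonnegative; since all measures
  involved have mass 1, the constant adds \<open>B\<close> on both sides and cancels.\<close>

lemma integral_bind_prob_algebra:
  fixes f :: "'y \<Rightarrow> real"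
  assumes \<mu>: "\<mu> \<in> space (prob_algebra X)" and \<kappa>: "\<kappa> \<in> X \<rightarrow>\<^sub>M prob_algebra Y"
    and f[measurable]: "f \<in> borel_measurable Y" and B: "\<And>y. y \<in> space Y \<Longrightarrow> \<bar>f y\<bar> \<le> B"
  shows "(\<integral>y. f y \<partial>(\<mu> \<bind> \<kappa>)) = (\<integral>x. \<integral>y. f y \<partial>\<kappa> x \<partial>\<mu>)"
proof -
  have sets[measurable_cong]: "sets \<mu> = sets X" and "prob_space \<mu>"
    using \<mu> by (auto simp: space_prob_algebra)
  interpret prob_space \<mu> by fact
  have sp: "space \<mu> = space X" using sets by (rule sets_eq_imp_space_eq)
  have space_eq: "space \<rho> = space Y" if "\<rho> \<in> space (prob_algebra Y)" for \<rho>
    using that by (auto simp: space_prob_algebra dest: sets_eq_imp_space_eq)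
  note \<kappa>S[measurable] = measurable_prob_algebraD[OF \<kappa>]
  have nonneg: "(\<integral>y. h y \<partial>(\<mu> \<bind> \<kappa>)) = (\<integral>x. \<integral>y. h y \<partial>\<kappa> x \<partial>\<mu>)"
    if [measurable]: "h \<in> borel_measurable Y" and h: "\<And>y. y \<in> space Y \<Longrightarrow> 0 \<le> h y"
      and hB: "\<And>y. y \<in> space Y \<Longrightarrow> \<bar>h y\<bar> \<le> C" for h :: "'y \<Rightarrow> real" and C
  proof -
    have \<kappa>x: "\<kappa> x \<in> space (prob_algebra Y)" if "x \<in> space X" for x
      using measurable_space[OF \<kappa> that] .
    have mu\<kappa>: "\<mu> \<bind> \<kappa> \<in> space (prob_algebra Y)" by (rule bind_in_space_prob_algebra[OF \<mu> \<kappa>])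
    have eq: "(\<integral>\<^sup>+y. ennreal (h y) \<partial>\<rho>) = ennreal (\<integral>y. h y \<partial>\<rho>)" if "\<rho> \<in> space (prob_algebra Y)" for \<rho>
      by (intro nn_integral_eq_integral integrable_bounded_prob_algebra[OF that, where B=C] AE_I2)
        (use h hB space_eq[OF that] in simp_all)
    have m: "(\<lambda>x. \<integral>y. h y \<partial>\<kappa> x) \<in> borel_measurable X" by measurable
    have nn: "0 \<le> (\<integral>y. h y \<partial>\<rho>)" if "\<rho> \<in> space (prob_algebra Y)" for \<rho>
      using h space_eq[OF that] by (intro integral_nonneg_AE AE_I2) simp
    have "ennreal (\<integral>y. h y \<partial>(\<mu> \<bind> \<kappa>)) = (\<integral>\<^sup>+y. ennreal (h y) \<partial>(\<mu> \<bind> \<kappa>))"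
      using eq[OF mu\<kappa>] by simp
    also have "\<dots> = (\<integral>\<^sup>+x. \<integral>\<^sup>+y. ennreal (h y) \<partial>\<kappa> x \<partial>\<mu>)"
      by (rule nn_integral_bind[where B=Y]) measurable
    also have "\<dots> = (\<integral>\<^sup>+x. ennreal (\<integral>y. h y \<partial>\<kappa> x) \<partial>\<mu>)"
      using eq[OF \<kappa>x] sp by (intro nn_integral_cong) auto
    also have "\<dots> = ennreal (\<integral>x. \<integral>y. h y \<partial>\<kappa> x \<partial>\<mu>)"
    proof (intro nn_integral_eq_integral integrable_bounded_prob_algebra[OF \<mu> m, where B=C] AE_I2)
      show "\<bar>\<integral>y. h y \<partial>\<kappa> x\<bar> \<le> C" if "x \<in> space X" for x
        using abs_integral_le_prob_algebra[OF \<kappa>x[OF that], of h C] hB by simp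
    qed (use nn[OF \<kappa>x] sp in simp)
    finally show ?thesis
    proof (subst (asm) ennreal_inj)
      show "0 \<le> (\<integral>x. \<integral>y. h y \<partial>\<kappa> x \<partial>\<mu>)"
        using nn[OF \<kappa>x] sp by (auto intro: Bochner_Integration.integral_nonneg)
    qed (use nn[OF mu\<kappa>] in auto)
  qed
  \<comment> \<open>After the shift the values lie between 0 and \<open>2 * B\<close>, hence the new
    bound.\<close>
  have "(\<integral>y. f y + B \<partial>(\<mu> \<bind> \<kappa>)) = (\<integral>x. \<integral>y. f y + B \<partial>\<kappa> x \<partial>\<mu>)"
    by (rule nonneg[of "\<lambda>y. f y + B" "2 * B"]) (use B in \<open>force simp: abs_le_iff\<close>)+
  moreover have int: "(\<integral>y. f y + B \<partial>\<rho>) = (\<integral>y. f y \<partial>\<rho>) + B" if "\<rho> \<in> space (prob_algebra Y)" for \<rho>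
  proof -
    interpret \<rho>: prob_space \<rho> using that by (simp add: space_prob_algebra)
    show ?thesis
      using integrable_bounded_prob_algebra[OF that f, of B] B by (simp add: \<rho>.prob_space)
  qed
  moreover have "(\<integral>x. \<integral>y. f y + B \<partial>\<kappa> x \<partial>\<mu>) = (\<integral>x. (\<integral>y. f y \<partial>\<kappa> x) + B \<partial>\<mu>)"
    using int measurable_space[OF \<kappa>] sp by (intro Bochner_Integration.integral_cong) auto
  moreover have "integrable \<mu> (\<lambda>x. \<integral>y. f y \<partial>\<kappa> x)"
  proof (rule integrable_bounded_prob_algebra[OF \<mu>])
    show "\<bar>\<integral>y. f y \<partial>\<kappa> x\<bar> \<le> B" if "x \<in> space X" for x
      using abs_integral_le_prob_algebra[OF measurable_space[OF \<kappa> that] f] B by simp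
  qed measurable
  ultimately show ?thesis
    using bind_in_space_prob_algebra[OF \<mu> \<kappa>] by (simp add: prob_space)
qed

section \<open>The kernels of the decision process and the marginals of its trajectories\<close>

locale gamdp =
  fixes M :: "('s, 'a, 'g) gamdp"
  assumes gamdp: "is_gamdp M"
begin

abbreviation "\<S> \<equiv> states M"
abbreviation "\<A> \<equiv> actions M"
abbreviation "\<G> \<equiv> goals M"
abbreviation "\<gamma> \<equiv> discount M"

lemma trans_measurable[measurable]: "(\<lambda>(s, a). trans M s a) \<in> \<S> \<Otimes>\<^sub>M \<A> \<rightarrow>\<^sub>M prob_algebra \<S>"
  using gamdp by (simp add: is_gamdp_def)

lemma reward_measurable[measurable]:
  "(\<lambda>(s, a, g). reward M s a g) \<in> borel_measurable (\<S> \<Otimes>\<^sub>M \<A> \<Otimes>\<^sub>M \<G>)"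
  using gamdp by (simp add: is_gamdp_def)

lemma discount: "0 \<le> \<gamma>" "\<gamma> < 1"
  using gamdp by (auto simp: is_gamdp_def)

lemma policy_measurable:
  assumes "is_policy M \<pi>"
  shows "(\<lambda>(s, g). \<pi> s g) \<in> \<S> \<Otimes>\<^sub>M \<G> \<rightarrow>\<^sub>M prob_algebra \<A>"
  using assms by (simp add: is_policy_def)

lemma move_measurable:
  assumes "is_policy M \<pi>"
  shows "(\<lambda>(s, g). move M \<pi> s g) \<in> \<S> \<Otimes>\<^sub>M \<G> \<rightarrow>\<^sub>M prob_algebra \<S>"
proof -
  note [measurable] = policy_measurable[OF assms]
  have "(\<lambda>x. (case x of (s, g) \<Rightarrow> \<pi> s g) \<bind> (\<lambda>a. trans M (fst x) a)) \<in> \<S> \<Otimes>\<^sub>M \<G> \<rightarrow>\<^sub>M prob_algebra \<S>"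
    by measurable
  then show ?thesis by (simp add: move_def case_prod_beta')
qed

text \<open>Joint measurability in state and goal is needed because \<open>visit_dist\<close>
  randomizes over both; the version for a fixed goal is a section of it.\<close>

lemma state_law_measurable:
  assumes "is_policy M \<pi>"
  shows "(\<lambda>(s, g). state_law M \<pi> t s g) \<in> \<S> \<Otimes>\<^sub>M \<G> \<rightarrow>\<^sub>M prob_algebra \<S>"
proof (induction t)
  case 0
  then show ?case by (simp add: case_prod_beta')
next
  case (Suc t)
  note [measurable] = Suc move_measurable[OF assms]
  have "(\<lambda>x. (case x of (s, g) \<Rightarrow> state_law M \<pi> t s g) \<bind>
      (\<lambda>s'. case (s', snd x) of (s, g) \<Rightarrow> move M \<pi> s g)) \<in> \<S> \<Otimes>\<^sub>M \<G> \<rightarrow>\<^sub>M prob_algebra \<S>"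
    by (intro measurable_bind_prob_space2[where N=\<S>]) measurable
  then show ?case by (simp add: case_prod_beta')
qed

end

text \<open>The goal never changes along a trajectory, so the analysis from one start pair takes
  place at a fixed \<open>g\<close>.\<close>

locale gamdp_policy = gamdp M for M :: "('s, 'a, 'g) gamdp" +
  fixes \<pi> :: "('s, 'a, 'g) policy" and g :: 'g
  assumes policy: "is_policy M \<pi>" and goal: "g \<in> space \<G>"
begin

lemma policy_measurable_goal[measurable]: "(\<lambda>s. \<pi> s g) \<in> \<S> \<rightarrow>\<^sub>M prob_algebra \<A>"
  using measurable_Pair_right[OF policy_measurable[OF policy] goal] by simp

lemma move_measurable_goal[measurable]: "(\<lambda>s. move M \<pi> s g) \<in> \<S> \<rightarrow>\<^sub>M prob_algebra \<S>"
  using measurable_Pair_right[OF move_measurable[OF policy] goal] by simp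

lemma state_law_measurable_goal[measurable]: "(\<lambda>s. state_law M \<pi> t s g) \<in> \<S> \<rightarrow>\<^sub>M prob_algebra \<S>"
  using measurable_Pair_right[OF state_law_measurable[OF policy] goal] by simp

lemma decide_action_measurable_goal[measurable]: "(\<lambda>s. decide_action M \<pi> s g) \<in> \<S> \<rightarrow>\<^sub>M prob_algebra (\<S> \<Otimes>\<^sub>M \<A>)"
  unfolding decide_action_def by (intro measurable_bind_prob_space2[where N=\<A>]) measurable

lemma state_law_in_space:
  "s \<in> space \<S> \<Longrightarrow> state_law M \<pi> t s g \<in> space (prob_algebra \<S>)"
  by (rule measurable_space[OF state_law_measurable_goal])

lemma policy_in_space: "s \<in> space \<S> \<Longrightarrow> \<pi> s g \<in> space (prob_algebra \<A>)"
  by (rule measurable_space[OF policy_measurable_goal])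

lemma trans_in_space: "s \<in> space \<S> \<Longrightarrow> a \<in> space \<A> \<Longrightarrow> trans M s a \<in> space (prob_algebra \<S>)"
  using measurable_space[OF trans_measurable, of "(s, a)"] by (simp add: space_pair_measure)

lemma trans_measurable_state: "s \<in> space \<S> \<Longrightarrow> trans M s \<in> \<A> \<rightarrow>\<^sub>M prob_algebra \<S>"
  using measurable_compose[OF measurable_Pair1' trans_measurable, of s] by simp

lemma bind_decide_action:
  assumes s: "s \<in> space \<S>" and h: "case_prod h \<in> \<S> \<Otimes>\<^sub>M \<A> \<rightarrow>\<^sub>M prob_algebra Z"
  shows "decide_action M \<pi> s g \<bind> (\<lambda>(s, a). h s a) = \<pi> s g \<bind> h s"
proof -
  have "decide_action M \<pi> s g \<bind> (\<lambda>(s, a). h s a)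
    = \<pi> s g \<bind> (\<lambda>a. return (\<S> \<Otimes>\<^sub>M \<A>) (s, a) \<bind> (\<lambda>(s, a). h s a))"
    unfolding decide_action_def using s h
    by (intro kernel_bind_assoc[OF policy_in_space[OF s] _ h]) measurable
  also have "\<dots> = \<pi> s g \<bind> h s"
  proof (intro bind_cong refl)
    fix a assume "a \<in> space (\<pi> s g)"
    then have "a \<in> space \<A>"
      using policy_in_space[OF s] by (auto simp: space_prob_algebra dest: sets_eq_imp_space_eq)
    then show "return (\<S> \<Otimes>\<^sub>M \<A>) (s, a) \<bind> (\<lambda>(s, a). h s a) = h s a"
      using kernel_return_bind[OF h, of "(s, a)"] s by (simp add: space_pair_measure)
  qed
  finally show ?thesis .
qed

lemma step_kernel_eq:
  "step_kernel M \<pi> s\<^sub>0 g t \<omega> =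
    (case t of 0 \<Rightarrow> return \<S> s\<^sub>0 | Suc j \<Rightarrow> trans M (fst (\<omega> j)) (snd (\<omega> j))) \<bind> (\<lambda>s. decide_action M \<pi> s g)"
  unfolding step_kernel_def decide_action_def ..

lemma step_kernel_measurable:
  assumes "s\<^sub>0 \<in> space \<S>"
  shows "step_kernel M \<pi> s\<^sub>0 g t \<in> (\<Pi>\<^sub>M i\<in>{0..<t}. \<S> \<Otimes>\<^sub>M \<A>) \<rightarrow>\<^sub>M prob_algebra (\<S> \<Otimes>\<^sub>M \<A>)"
proof (cases t)
  case 0
  have "(\<lambda>s. decide_action M \<pi> s g) s\<^sub>0 \<in> space (prob_algebra (\<S> \<Otimes>\<^sub>M \<A>))"
    by (rule measurable_space[OF decide_action_measurable_goal assms])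
  then show ?thesis
    using kernel_return_bind[OF decide_action_measurable_goal assms] 0
    by (simp add: step_kernel_eq[abs_def])
next
  case (Suc j)
  have [measurable]: "(\<lambda>\<omega>. \<omega> j) \<in> (\<Pi>\<^sub>M i\<in>{0..<t}. \<S> \<Otimes>\<^sub>M \<A>) \<rightarrow>\<^sub>M \<S> \<Otimes>\<^sub>M \<A>"
    using Suc by (intro measurable_component_singleton) auto
  have "(\<lambda>\<omega>. (case \<omega> j of (s, a) \<Rightarrow> trans M s a) \<bind> (\<lambda>s. decide_action M \<pi> s g))
    \<in> (\<Pi>\<^sub>M i\<in>{0..<t}. \<S> \<Otimes>\<^sub>M \<A>) \<rightarrow>\<^sub>M prob_algebra (\<S> \<Otimes>\<^sub>M \<A>)"
    by (intro measurable_bind_prob_space[where N=\<S>] decide_action_measurable_goal) measurable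
  then show ?thesis using Suc by (simp add: step_kernel_eq[abs_def] case_prod_beta')
qed

lemma Ionescu_Tulcea_step_kernel:
  assumes "s\<^sub>0 \<in> space \<S>"
  shows "Ionescu_Tulcea (step_kernel M \<pi> s\<^sub>0 g) (\<lambda>_. \<S> \<Otimes>\<^sub>M \<A>)"
proof (rule Ionescu_Tulcea.intro)
  fix t
  show "step_kernel M \<pi> s\<^sub>0 g t \<in> (\<Pi>\<^sub>M i\<in>{0..<t}. \<S> \<Otimes>\<^sub>M \<A>) \<rightarrow>\<^sub>M subprob_algebra (\<S> \<Otimes>\<^sub>M \<A>)"
    by (rule measurable_prob_algebraD[OF step_kernel_measurable[OF assms]])
next
  fix t :: nat and \<omega> assume "\<omega> \<in> space (\<Pi>\<^sub>M i\<in>{0..<t}. \<S> \<Otimes>\<^sub>M \<A>)"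
  from measurable_space[OF step_kernel_measurable[OF assms] this]
  show "prob_space (step_kernel M \<pi> s\<^sub>0 g t \<omega>)" by (simp add: space_prob_algebra)
qed

text \<open>The projective limit is accessible through its finite-dimensional marginals: coordinate
  \<open>t\<close> factors through the restriction to \<open>{t}\<close>, hence through the finite
  history of length \<open>Suc t\<close>. There it is the last value drawn, and since each step
  depends on the history only through its last entry, the marginals obey the recursion of
  \<open>state_law\<close>.\<close>

lemma
  assumes s0: "s\<^sub>0 \<in> space \<S>"
  shows sets_trajectory: "sets (trajectory M \<pi> s\<^sub>0 g) = sets (\<Pi>\<^sub>M i\<in>UNIV. \<S> \<Otimes>\<^sub>M \<A>)"
    and distr_trajectory: "distr (trajectory M \<pi> s\<^sub>0 g) (\<S> \<Otimes>\<^sub>M \<A>) (\<lambda>\<omega>. \<omega> t) =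
      state_law M \<pi> t s\<^sub>0 g \<bind> (\<lambda>s. decide_action M \<pi> s g)" (is "?D = _")
proof -
  interpret IT: Ionescu_Tulcea "step_kernel M \<pi> s\<^sub>0 g" "\<lambda>_. \<S> \<Otimes>\<^sub>M \<A>"
    by (rule Ionescu_Tulcea_step_kernel[OF s0])
  have traj: "trajectory M \<pi> s\<^sub>0 g = IT.PF.lim" by (simp add: trajectory_def)
  show sets: "sets (trajectory M \<pi> s\<^sub>0 g) = sets (\<Pi>\<^sub>M i\<in>UNIV. \<S> \<Otimes>\<^sub>M \<A>)"
    by (simp add: traj)
  \<comment> \<open>The empty history: over the index set \<open>{0..<0}\<close> the only
    extensional function is constantly \<open>undefined\<close>.\<close>
  define u :: "nat \<Rightarrow> 's \<times> 'a" where "u = (\<lambda>_. undefined)"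
  have u: "u \<in> space (\<Pi>\<^sub>M i\<in>{0..<0}. \<S> \<Otimes>\<^sub>M \<A>)" by (simp add: u_def space_PiM)
  have comp: "(\<lambda>\<omega>. \<omega> t) \<in> (\<Pi>\<^sub>M i\<in>J. \<S> \<Otimes>\<^sub>M \<A>) \<rightarrow>\<^sub>M \<S> \<Otimes>\<^sub>M \<A>" if "t \<in> J" for t :: nat and J
    using that by (rule measurable_component_singleton)
  have law_step: "distr (IT.C 0 (Suc t) u) (\<S> \<Otimes>\<^sub>M \<A>) (\<lambda>\<omega>. \<omega> t)
      = IT.C 0 t u \<bind> step_kernel M \<pi> s\<^sub>0 g t" for t
  proof -
    have ne: "space (IT.C 0 t u) \<noteq> {}" using IT.prob_space_C[OF u] prob_space.not_empty by blast
    have "distr (IT.C 0 (Suc t) u) (\<S> \<Otimes>\<^sub>M \<A>) (\<lambda>\<omega>. \<omega> t)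
      = IT.C 0 t u \<bind> (\<lambda>\<omega>. distr (IT.eP t \<omega>) (\<S> \<Otimes>\<^sub>M \<A>) (\<lambda>\<omega>. \<omega> t))"
      using IT.measurable_eP[of t] IT.sets_C[OF u, of t] ne
      by (simp, intro distr_bind[where K="\<Pi>\<^sub>M i\<in>{0..<Suc t}. \<S> \<Otimes>\<^sub>M \<A>"] comp)
        (auto cong: measurable_cong_sets)
    also have "\<dots> = IT.C 0 t u \<bind> step_kernel M \<pi> s\<^sub>0 g t"
    proof (intro bind_cong refl)
      fix \<omega> assume "\<omega> \<in> space (IT.C 0 t u)"
      then have \<omega>: "\<omega> \<in> space (\<Pi>\<^sub>M i\<in>{0..<t}. \<S> \<Otimes>\<^sub>M \<A>)" using IT.space_C[OF u] by simp
      have upd: "fun_upd \<omega> t \<in> step_kernel M \<pi> s\<^sub>0 g t \<omega> \<rightarrow>\<^sub>M (\<Pi>\<^sub>M i\<in>{0..<Suc t}. \<S> \<Otimes>\<^sub>M \<A>)"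
        using \<omega> IT.sets_P[OF \<omega>] by (intro measurable_fun_upd[where J="{0..<t}"]) auto
      \<comment> \<open>\<open>IT.eP\<close> writes the newly drawn value at index \<open>t\<close>
        of the history; evaluating there returns just that value.\<close>
      show "distr (IT.eP t \<omega>) (\<S> \<Otimes>\<^sub>M \<A>) (\<lambda>\<omega>. \<omega> t) = step_kernel M \<pi> s\<^sub>0 g t \<omega>"
        unfolding IT.eP_def using IT.sets_P[OF \<omega>]
        by (subst distr_distr[OF comp upd]) (auto simp: comp_def intro!: distr_id2)
    qed
    finally show ?thesis .
  qed
  have "?D = distr (distr IT.PF.lim (\<Pi>\<^sub>M i\<in>{t}. \<S> \<Otimes>\<^sub>M \<A>) (\<lambda>x. restrict x {t})) (\<S> \<Otimes>\<^sub>M \<A>) (\<lambda>\<omega>. \<omega> t)"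
    unfolding traj by (subst distr_distr) (auto simp: comp_def intro!: comp measurable_restrict_subset
      cong: measurable_cong_sets)
  also have "\<dots> = distr (IT.CI {t}) (\<S> \<Otimes>\<^sub>M \<A>) (\<lambda>\<omega>. \<omega> t)"
    by (simp add: IT.distr_lim)
  \<comment> \<open>Histories of length \<open>n\<close> have indices below \<open>n\<close>, so
    index \<open>t\<close> first occurs at length \<open>Suc t\<close>.\<close>
  also have "IT.up_to {t} = Suc t"
    using IT.up_to_iff[of "{t}"] by (intro antisym) (auto simp: Suc_le_eq IT.up_to_less)
  then have "distr (IT.CI {t}) (\<S> \<Otimes>\<^sub>M \<A>) (\<lambda>\<omega>. \<omega> t) = distr (IT.C 0 (Suc t) u) (\<S> \<Otimes>\<^sub>M \<A>) (\<lambda>\<omega>. \<omega> t)"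
    unfolding IT.CI_def u_def[symmetric] using IT.sets_C[OF u, of "Suc t"]
    by (subst distr_distr) (auto simp: comp_def intro!: comp measurable_restrict_subset
      simp del: IT.C.simps cong: measurable_cong_sets)
  also have "\<dots> = state_law M \<pi> t s\<^sub>0 g \<bind> (\<lambda>s. decide_action M \<pi> s g)"
  proof (induction t)
    case 0
    show ?case
      unfolding law_step using IT.C.simps(1)[of 0 u] u
        bind_return[OF measurable_prob_algebraD[OF step_kernel_measurable[OF s0, of 0]] u]
      by (simp add: step_kernel_eq)
  next
    case (Suc t)
    let ?h = "\<lambda>s a. trans M s a \<bind> (\<lambda>s. decide_action M \<pi> s g)"
    have h[measurable]: "case_prod ?h \<in> \<S> \<Otimes>\<^sub>M \<A> \<rightarrow>\<^sub>M prob_algebra (\<S> \<Otimes>\<^sub>M \<A>)"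
      using measurable_bind_prob_space[OF trans_measurable decide_action_measurable_goal]
      by (simp add: case_prod_beta')
    have ne: "space (IT.C 0 (Suc t) u) \<noteq> {}" using IT.prob_space_C[OF u] prob_space.not_empty by blast
    \<comment> \<open>The Markov property: the kernel sees the history only through
      \<open>\<omega> t\<close>, so the bind factors through the marginal at time \<open>t\<close>,
      to which the induction hypothesis applies.\<close>
    have "distr (IT.C 0 (Suc (Suc t)) u) (\<S> \<Otimes>\<^sub>M \<A>) (\<lambda>\<omega>. \<omega> (Suc t))
      = IT.C 0 (Suc t) u \<bind> (\<lambda>\<omega>. case_prod ?h (\<omega> t))"
      unfolding law_step by (intro bind_cong refl) (simp add: step_kernel_eq case_prod_beta')
    also have "\<dots> = distr (IT.C 0 (Suc t) u) (\<S> \<Otimes>\<^sub>M \<A>) (\<lambda>\<omega>. \<omega> t) \<bind> case_prod ?h"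
      using IT.sets_C[OF u, of "Suc t"] ne h
      by (intro bind_distr[symmetric, where K="\<S> \<Otimes>\<^sub>M \<A>"])
        (auto intro!: comp measurable_prob_algebraD simp del: IT.C.simps cong: measurable_cong_sets)
    also have "\<dots> = state_law M \<pi> t s\<^sub>0 g \<bind> (\<lambda>s. decide_action M \<pi> s g \<bind> case_prod ?h)"
      unfolding Suc by (rule kernel_bind_assoc[OF state_law_in_space[OF s0]]) measurable
    also have "\<dots> = state_law M \<pi> t s\<^sub>0 g \<bind> (\<lambda>s. move M \<pi> s g \<bind> (\<lambda>s. decide_action M \<pi> s g))"
    proof (intro bind_cong refl)
      fix s assume "s \<in> space (state_law M \<pi> t s\<^sub>0 g)"
      then have s: "s \<in> space \<S>"
        using state_law_in_space[OF s0, of t] by (auto simp: space_prob_algebra dest: sets_eq_imp_space_eq)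
      show "decide_action M \<pi> s g \<bind> case_prod ?h = move M \<pi> s g \<bind> (\<lambda>s. decide_action M \<pi> s g)"
        unfolding move_def
        using bind_decide_action[OF s h] kernel_bind_assoc[OF policy_in_space[OF s] trans_measurable_state[OF s] decide_action_measurable_goal]
        by simp
    qed
    also have "\<dots> = state_law M \<pi> (Suc t) s\<^sub>0 g \<bind> (\<lambda>s. decide_action M \<pi> s g)"
      by (simp add: kernel_bind_assoc[OF state_law_in_space[OF s0] move_measurable_goal decide_action_measurable_goal])
    finally show ?case .
  qed
  finally show "?D = state_law M \<pi> t s\<^sub>0 g \<bind> (\<lambda>s. decide_action M \<pi> s g)" .
qed

end

subsection \<open>Occupancy\<close>

lemma space_of_prob_algebra: "\<mu> \<in> space (prob_algebra X) \<Longrightarrow> space \<mu> = space X"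
  by (auto simp: space_prob_algebra dest: sets_eq_imp_space_eq)

lemma summable_discounted:
  fixes c :: real and f :: "nat \<Rightarrow> real"
  assumes "0 \<le> c" "c < 1" "\<And>t. \<bar>f t\<bar> \<le> B"
  shows "summable (\<lambda>t. c ^ t * f t)"
proof (rule summable_comparison_test)
  show "\<exists>N. \<forall>t\<ge>N. norm (c ^ t * f t) \<le> c ^ t * B"
    using assms by (auto simp: abs_mult intro!: mult_left_mono)
qed (use assms in \<open>auto intro: summable_mult2 summable_geometric\<close>)

lemma abs_suminf_discounted_le:
  fixes c :: real and f :: "nat \<Rightarrow> real"
  assumes "0 \<le> c" "c < 1" "\<And>t. \<bar>f t\<bar> \<le> B"
  shows "\<bar>\<Sum>t. c ^ t * f t\<bar> \<le> B / (1 - c)"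
proof -
  have B: "(\<lambda>t. c ^ t * B) sums (1 / (1 - c) * B)"
    using assms by (intro sums_mult2 geometric_sums) auto
  have "norm (\<Sum>t. c ^ t * f t) \<le> (\<Sum>t. c ^ t * B)"
    using assms B by (intro norm_suminf_le) (auto simp: abs_mult sums_iff intro!: mult_left_mono)
  then show ?thesis using B by (simp add: sums_iff)
qed

lemma integral_suminf_discounted:
  fixes c :: real and f :: "nat \<Rightarrow> 'x \<Rightarrow> real"
  assumes \<mu>: "\<mu> \<in> space (prob_algebra X)" and c: "0 \<le> c" "c < 1"
    and f: "\<And>t. f t \<in> borel_measurable X" and B: "\<And>t x. x \<in> space X \<Longrightarrow> \<bar>f t x\<bar> \<le> B"
  shows "(\<integral>x. (\<Sum>t. c ^ t * f t x) \<partial>\<mu>) = (\<Sum>t. c ^ t * (\<integral>x. f t x \<partial>\<mu>))"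
proof -
  have int: "integrable \<mu> (f t)" for t
    using integrable_bounded_prob_algebra[OF \<mu> f[of t], of B] B by simp
  have "(\<integral>x. (\<Sum>t. c ^ t * f t x) \<partial>\<mu>) = (\<Sum>t. \<integral>x. c ^ t * f t x \<partial>\<mu>)"
  proof (rule integral_suminf)
    show "AE x in \<mu>. summable (\<lambda>t. norm (c ^ t * f t x))"
    proof (rule AE_I2)
      fix x assume "x \<in> space \<mu>"
      then have "summable (\<lambda>t. c ^ t * \<bar>f t x\<bar>)"
        using B space_of_prob_algebra[OF \<mu>] c by (intro summable_discounted[where B=B]) auto
      then show "summable (\<lambda>t. norm (c ^ t * f t x))" using c by (simp add: abs_mult)
    qed
    have "\<bar>\<integral>x. \<bar>f t x\<bar> \<partial>\<mu>\<bar> \<le> B" for t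
      using abs_integral_le_prob_algebra[OF \<mu>, of "\<lambda>x. \<bar>f t x\<bar>" B] B f by simp
    from summable_discounted[OF c this]
    show "summable (\<lambda>t. \<integral>x. norm (c ^ t * f t x) \<partial>\<mu>)" using c by (simp add: abs_mult)
  qed (use int in simp)
  then show ?thesis by simp
qed

text \<open>The normalized discount weights \<open>(1 - c) * c ^ t\<close> are the probabilities of
  a geometric time. This turns discounted averages into a bind, to which the kernel rules
  apply.\<close>

lemma integral_geometric_pmf:
  fixes h :: "nat \<Rightarrow> real"
  assumes c: "0 \<le> c" "c < 1" and h: "\<And>t. \<bar>h t\<bar> \<le> B"
  shows "(\<integral>t. h t \<partial>measure_pmf (geometric_pmf (1 - c))) = (1 - c) * (\<Sum>t. c ^ t * h t)"
proof -
  have s: "summable (\<lambda>t. c ^ t * h t)" "summable (\<lambda>t. c ^ t * \<bar>h t\<bar>)"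
    using c h by (intro summable_discounted[where B=B]; simp)+
  have "summable (\<lambda>t. norm ((1 - c) * c ^ t * h t))"
    using summable_mult[OF s(2), of "1 - c"] c by (simp add: abs_mult mult_ac)
  then have "integrable (count_space UNIV) (\<lambda>t. c ^ t * (1 - c) * h t)"
    by (simp add: integrable_count_space_nat_iff mult_ac)
  then have "(\<integral>t. h t \<partial>measure_pmf (geometric_pmf (1 - c))) = (\<Sum>t. c ^ t * (1 - c) * h t)"
    using c by (simp add: measure_pmf_eq_density integral_density integral_count_space_nat)
  then show ?thesis
    using suminf_mult[OF s(1), of "1 - c"] by (simp add: mult_ac)
qed

context gamdp
begin

lemma geometric_mixture_measurable:
  assumes "is_policy M \<pi>"
  shows "(\<lambda>(s, g). measure_pmf (geometric_pmf (1 - \<gamma>)) \<bind> (\<lambda>t. state_law M \<pi> t s g))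
    \<in> \<S> \<Otimes>\<^sub>M \<G> \<rightarrow>\<^sub>M prob_algebra \<S>"
proof -
  have "(\<lambda>x. measure_pmf (geometric_pmf (1 - \<gamma>)) \<bind> (\<lambda>t. case x of (s, g) \<Rightarrow> state_law M \<pi> t s g))
    \<in> \<S> \<Otimes>\<^sub>M \<G> \<rightarrow>\<^sub>M prob_algebra \<S>"
  proof (rule measurable_bind_prob_space2[where N="count_space UNIV"])
    show "(\<lambda>x. measure_pmf (geometric_pmf (1 - \<gamma>))) \<in> \<S> \<Otimes>\<^sub>M \<G> \<rightarrow>\<^sub>M prob_algebra (count_space UNIV)"
      by (simp add: space_prob_algebra measure_pmf.prob_space_axioms)
    \<comment> \<open>Times are countably many, so measurability at each fixed time suffices for
      measurability in start pair and time together.\<close>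
    have "(\<lambda>x. case fst x of (s, g) \<Rightarrow> state_law M \<pi> (snd x) s g)
        \<in> (\<S> \<Otimes>\<^sub>M \<G>) \<Otimes>\<^sub>M count_space UNIV \<rightarrow>\<^sub>M prob_algebra \<S>"
      by (rule measurable_compose_countable[OF measurable_compose[OF measurable_fst state_law_measurable[OF assms]] measurable_snd])
    then show "(\<lambda>(x, t). case x of (s, g) \<Rightarrow> state_law M \<pi> t s g)
        \<in> (\<S> \<Otimes>\<^sub>M \<G>) \<Otimes>\<^sub>M count_space UNIV \<rightarrow>\<^sub>M prob_algebra \<S>"
      by (simp add: case_prod_beta')
  qed
  then show ?thesis by (simp add: case_prod_beta')
qed

end

context gamdp_policy
begin

text \<open>A push-forward keeps the total mass, so it suffices that the marginal at time 0 is a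
  probability measure.\<close>

lemma trajectory_in_space:
  assumes "s\<^sub>0 \<in> space \<S>"
  shows "trajectory M \<pi> s\<^sub>0 g \<in> space (prob_algebra (\<Pi>\<^sub>M i\<in>UNIV. \<S> \<Otimes>\<^sub>M \<A>))"
proof -
  have "state_law M \<pi> 0 s\<^sub>0 g \<bind> (\<lambda>s. decide_action M \<pi> s g) \<in> space (prob_algebra (\<S> \<Otimes>\<^sub>M \<A>))"
    by (rule bind_in_space_prob_algebra[OF state_law_in_space[OF assms] decide_action_measurable_goal])
  then have "prob_space (distr (trajectory M \<pi> s\<^sub>0 g) (\<S> \<Otimes>\<^sub>M \<A>) (\<lambda>\<omega>. \<omega> 0))"
    unfolding distr_trajectory[OF assms] by (simp add: space_prob_algebra)
  then have "prob_space (trajectory M \<pi> s\<^sub>0 g)"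
    by (rule prob_space_distrD[rotated])
      (simp add: measurable_cong_sets[OF sets_trajectory[OF assms] refl])
  then show ?thesis using sets_trajectory[OF assms] by (simp add: space_prob_algebra)
qed

lemma integral_decide_action:
  fixes h :: "'s \<times> 'a \<Rightarrow> real"
  assumes s: "s \<in> space \<S>" and h: "h \<in> borel_measurable (\<S> \<Otimes>\<^sub>M \<A>)"
    and B: "\<And>x. x \<in> space (\<S> \<Otimes>\<^sub>M \<A>) \<Longrightarrow> \<bar>h x\<bar> \<le> B"
  shows "(\<integral>x. h x \<partial>decide_action M \<pi> s g) = (\<integral>a. h (s, a) \<partial>\<pi> s g)"
proof -
  have "(\<integral>x. h x \<partial>decide_action M \<pi> s g)
    = (\<integral>a. \<integral>x. h x \<partial>return (\<S> \<Otimes>\<^sub>M \<A>) (s, a) \<partial>\<pi> s g)"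
    unfolding decide_action_def
    by (rule integral_bind_prob_algebra[OF policy_in_space[OF s] _ h B]) (use s in measurable)
  also have "\<dots> = (\<integral>a. h (s, a) \<partial>\<pi> s g)"
    using s h space_of_prob_algebra[OF policy_in_space[OF s]]
    by (intro Bochner_Integration.integral_cong refl integral_return) (auto simp: space_pair_measure)
  finally show ?thesis .
qed

lemma integral_trajectory:
  fixes h :: "'s \<times> 'a \<Rightarrow> real"
  assumes s0: "s\<^sub>0 \<in> space \<S>" and h: "h \<in> borel_measurable (\<S> \<Otimes>\<^sub>M \<A>)"
    and B: "\<And>x. x \<in> space (\<S> \<Otimes>\<^sub>M \<A>) \<Longrightarrow> \<bar>h x\<bar> \<le> B"
  shows "(\<integral>\<omega>. h (\<omega> t) \<partial>trajectory M \<pi> s\<^sub>0 g) = (\<integral>s. \<integral>a. h (s, a) \<partial>\<pi> s g \<partial>state_law M \<pi> t s\<^sub>0 g)"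
proof -
  have "(\<integral>\<omega>. h (\<omega> t) \<partial>trajectory M \<pi> s\<^sub>0 g)
    = (\<integral>x. h x \<partial>distr (trajectory M \<pi> s\<^sub>0 g) (\<S> \<Otimes>\<^sub>M \<A>) (\<lambda>\<omega>. \<omega> t))"
    using h by (intro integral_distr[symmetric])
      (simp_all add: measurable_cong_sets[OF sets_trajectory[OF s0] refl])
  also have "\<dots> = (\<integral>s. \<integral>x. h x \<partial>decide_action M \<pi> s g \<partial>state_law M \<pi> t s\<^sub>0 g)"
    unfolding distr_trajectory[OF s0]
    by (rule integral_bind_prob_algebra[OF state_law_in_space[OF s0] decide_action_measurable_goal h B])
  also have "\<dots> = (\<integral>s. \<integral>a. h (s, a) \<partial>\<pi> s g \<partial>state_law M \<pi> t s\<^sub>0 g)"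
    using space_of_prob_algebra[OF state_law_in_space[OF s0]]
    by (intro Bochner_Integration.integral_cong refl integral_decide_action[OF _ h B]) auto
  finally show ?thesis .
qed

lemma prob_trajectory_state:
  assumes s0: "s\<^sub>0 \<in> space \<S>" and B: "B \<in> sets \<S>"
  shows "\<P>(\<omega> in trajectory M \<pi> s\<^sub>0 g. fst (\<omega> t) \<in> B) = measure (state_law M \<pi> t s\<^sub>0 g) B"
proof -
  let ?T = "trajectory M \<pi> s\<^sub>0 g" and ?L = "state_law M \<pi> t s\<^sub>0 g"
  let ?h = "\<lambda>x :: 's \<times> 'a. indicator B (fst x) :: real"
  have sp: "space ?T = space (\<Pi>\<^sub>M i\<in>UNIV. \<S> \<Otimes>\<^sub>M \<A>)"
    using sets_trajectory[OF s0] by (rule sets_eq_imp_space_eq)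
  have "\<P>(\<omega> in ?T. fst (\<omega> t) \<in> B) = (\<integral>\<omega>. indicator {\<omega> \<in> space ?T. fst (\<omega> t) \<in> B} \<omega> \<partial>?T)"
    by (simp add: Int_absorb2 subset_eq)
  also have "\<dots> = (\<integral>\<omega>. ?h (\<omega> t) \<partial>?T)"
    by (intro Bochner_Integration.integral_cong) (auto split: split_indicator)
  also have "\<dots> = (\<integral>s. \<integral>a. ?h (s, a) \<partial>\<pi> s g \<partial>?L)"
    using B by (intro integral_trajectory[OF s0, where B=1]) auto
  also have "\<dots> = (\<integral>s. indicator B s \<partial>?L)"
  proof (intro Bochner_Integration.integral_cong refl)
    fix s assume "s \<in> space ?L"
    then have s: "s \<in> space \<S>" using space_of_prob_algebra[OF state_law_in_space[OF s0]] by simp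
    interpret prob_space "\<pi> s g" using policy_in_space[OF s] by (simp add: space_prob_algebra)
    show "(\<integral>a. ?h (s, a) \<partial>\<pi> s g) = indicator B s" by (simp add: prob_space)
  qed
  also have "\<dots> = measure ?L B"
    using B sets.sets_into_space[OF B] space_of_prob_algebra[OF state_law_in_space[OF s0], of t]
    by (simp add: Int_absorb2)
  finally show ?thesis .
qed

text \<open>\<open>measure_of\<close> returns the prescribed set function only if that function is
  countably additive. Its agreement on measurable sets with the mixture of the state laws over a
  geometric time provides this.\<close>

lemma occupancy_eq:
  assumes s0: "s\<^sub>0 \<in> space \<S>"
  shows "occupancy M \<pi> s\<^sub>0 g = measure_pmf (geometric_pmf (1 - \<gamma>)) \<bind> (\<lambda>t. state_law M \<pi> t s\<^sub>0 g)"
    (is "_ = ?N")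
proof -
  have m: "(\<lambda>t. state_law M \<pi> t s\<^sub>0 g) \<in> count_space UNIV \<rightarrow>\<^sub>M prob_algebra \<S>"
    using state_law_in_space[OF s0] by simp
  have pmf: "measure_pmf (geometric_pmf (1 - \<gamma>)) \<in> space (prob_algebra (count_space UNIV))"
    by (simp add: space_prob_algebra measure_pmf.prob_space_axioms)
  have N: "?N \<in> space (prob_algebra \<S>)" by (rule bind_in_space_prob_algebra[OF pmf m])
  have le1: "measure (state_law M \<pi> t s\<^sub>0 g) B \<le> 1" for t B
    using state_law_in_space[OF s0, of t] by (auto simp: space_prob_algebra prob_space.prob_le_1)
  have "ennreal ((1 - \<gamma>) * (\<Sum>t. \<gamma> ^ t * \<P>(\<omega> in trajectory M \<pi> s\<^sub>0 g. fst (\<omega> t) \<in> B))) = emeasure ?N B"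
    if B: "B \<in> sets \<S>" for B
  proof -
    interpret N: prob_space ?N using N by (simp add: space_prob_algebra)
    have "measure ?N B = (\<integral>s. indicator B s \<partial>?N)"
      using B sets.sets_into_space[OF B] space_of_prob_algebra[OF N] by (simp add: Int_absorb2)
    also have "\<dots> = (\<integral>t. \<integral>s. indicator B s \<partial>state_law M \<pi> t s\<^sub>0 g \<partial>measure_pmf (geometric_pmf (1 - \<gamma>)))"
      using B by (intro integral_bind_prob_algebra[OF pmf m, where B=1]) auto
    also have "\<dots> = (\<integral>t. measure (state_law M \<pi> t s\<^sub>0 g) B \<partial>measure_pmf (geometric_pmf (1 - \<gamma>)))"
      using B sets.sets_into_space[OF B] space_of_prob_algebra[OF state_law_in_space[OF s0]]
      by (simp add: Int_absorb2)
    also have "\<dots> = (1 - \<gamma>) * (\<Sum>t. \<gamma> ^ t * measure (state_law M \<pi> t s\<^sub>0 g) B)"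
      using discount le1 by (intro integral_geometric_pmf[where B=1]) auto
    finally show ?thesis
      by (simp add: prob_trajectory_state[OF s0 B] N.emeasure_eq_measure)
  qed
  then have "occupancy M \<pi> s\<^sub>0 g = measure_of (space \<S>) (sets \<S>) (emeasure ?N)"
    unfolding occupancy_def by (intro measure_of_eq sets.space_closed) (simp add: sets.sigma_sets_eq)
  also have "\<dots> = ?N"
    using N measure_of_of_measure[of ?N] space_of_prob_algebra[OF N] by (simp add: space_prob_algebra)
  finally show ?thesis .
qed

lemma occupancy_in_space: "s \<in> space \<S> \<Longrightarrow> occupancy M \<pi> s g \<in> space (prob_algebra \<S>)"
  using measurable_space[OF geometric_mixture_measurable[OF policy], of "(s, g)"] goal
  by (simp add: occupancy_eq space_pair_measure)

lemma integral_occupancy: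
  fixes h :: "'s \<Rightarrow> real"
  assumes s0: "s\<^sub>0 \<in> space \<S>" and h: "h \<in> borel_measurable \<S>"
    and B: "\<And>s. s \<in> space \<S> \<Longrightarrow> \<bar>h s\<bar> \<le> B"
  shows "(\<integral>s. h s \<partial>occupancy M \<pi> s\<^sub>0 g) = (1 - \<gamma>) * (\<Sum>t. \<gamma> ^ t * (\<integral>s. h s \<partial>state_law M \<pi> t s\<^sub>0 g))"
proof -
  have "(\<integral>s. h s \<partial>occupancy M \<pi> s\<^sub>0 g)
      = (\<integral>t. \<integral>s. h s \<partial>state_law M \<pi> t s\<^sub>0 g \<partial>measure_pmf (geometric_pmf (1 - \<gamma>)))"
    unfolding occupancy_eq[OF s0]
  proof (rule integral_bind_prob_algebra[OF _ _ h B])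
    show "measure_pmf (geometric_pmf (1 - \<gamma>)) \<in> space (prob_algebra (count_space UNIV))"
      by (simp add: space_prob_algebra measure_pmf.prob_space_axioms)
  qed (use state_law_in_space[OF s0] in auto)
  also have "\<dots> = (1 - \<gamma>) * (\<Sum>t. \<gamma> ^ t * (\<integral>s. h s \<partial>state_law M \<pi> t s\<^sub>0 g))"
    using abs_integral_le_prob_algebra[OF state_law_in_space[OF s0] h B]
    by (intro integral_geometric_pmf discount)
  finally show ?thesis .
qed

end

lemma (in gamdp) occupancy_measurable:
  assumes "is_policy M \<pi>"
  shows "(\<lambda>(s, g). occupancy M \<pi> s g) \<in> \<S> \<Otimes>\<^sub>M \<G> \<rightarrow>\<^sub>M prob_algebra \<S>"
proof (subst measurable_cong)
  fix x assume "x \<in> space (\<S> \<Otimes>\<^sub>M \<G>)"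
  then obtain s g where x: "x = (s, g)" "s \<in> space \<S>" "g \<in> space \<G>" by (auto simp: space_pair_measure)
  interpret gamdp_policy M \<pi> g using assms x by unfold_locales
  show "(case x of (s, g) \<Rightarrow> occupancy M \<pi> s g) =
    (case x of (s, g) \<Rightarrow> measure_pmf (geometric_pmf (1 - \<gamma>)) \<bind> (\<lambda>t. state_law M \<pi> t s g))"
    using occupancy_eq[OF x(2)] x(1) by simp
qed (rule geometric_mixture_measurable[OF assms])

subsection \<open>The value gap\<close>

context gamdp
begin

abbreviation "R \<equiv> R_max M"

lemma abs_reward_le:
  assumes "s \<in> space \<S>" "a \<in> space \<A>" "g \<in> space \<G>"
  shows "\<bar>reward M s a g\<bar> \<le> R"
proof -
  have "(case (s, a, g) of (s, a, g) \<Rightarrow> \<bar>reward M s a g\<bar>) \<le> R"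
    unfolding R_max_def using gamdp assms by (intro cSUP_upper) (auto simp: is_gamdp_def)
  then show ?thesis by simp
qed

end

section \<open>The value function as a discounted series and its Bellman equation\<close>

context gamdp_policy
begin

definition "mean_reward s = (\<integral>a. reward M s a g \<partial>\<pi> s g)"

lemma reward_measurable_goal[measurable]:
  "(\<lambda>(s, a). reward M s a g) \<in> borel_measurable (\<S> \<Otimes>\<^sub>M \<A>)"
proof -
  have "(\<lambda>x. (case (fst x, snd x, g) of (s, a, g) \<Rightarrow> reward M s a g)) \<in> borel_measurable (\<S> \<Otimes>\<^sub>M \<A>)"
    by (rule measurable_compose[OF _ reward_measurable]) (use goal in measurable)
  then show ?thesis by (simp add: case_prod_beta')
qed

text \<open>In the definition both the integrand and the measure vary with \<open>s\<close>.
  Integrating over pairs drawn by \<open>decide_action\<close> leaves a fixed integrand and moves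
  all dependence on \<open>s\<close> into the kernel.\<close>

lemma mean_reward_measurable[measurable]: "mean_reward \<in> borel_measurable \<S>"
proof -
  have "(\<lambda>s. \<integral>x. (case x of (s, a) \<Rightarrow> reward M s a g) \<partial>decide_action M \<pi> s g) \<in> borel_measurable \<S>"
    by (rule measurable_compose[OF measurable_prob_algebraD[OF decide_action_measurable_goal]
          integral_measurable_subprob_algebra[OF reward_measurable_goal]])
  moreover have "(\<integral>x. (case x of (s, a) \<Rightarrow> reward M s a g) \<partial>decide_action M \<pi> s g) = mean_reward s"
    if "s \<in> space \<S>" for s
    using that goal abs_reward_le
    by (subst integral_decide_action[where B=R]) (auto simp: mean_reward_def space_pair_measure)
  ultimately show ?thesis by (simp cong: measurable_cong)
qed

lemma reward_measurable_action: "s \<in> space \<S> \<Longrightarrow> (\<lambda>a. reward M s a g) \<in> borel_measurable \<A>"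
  using measurable_compose[OF measurable_Pair1' reward_measurable_goal, of s] by simp

lemma abs_mean_reward_le: "s \<in> space \<S> \<Longrightarrow> \<bar>mean_reward s\<bar> \<le> R"
  unfolding mean_reward_def using goal
  by (intro abs_integral_le_prob_algebra[OF policy_in_space] abs_reward_le reward_measurable_action)

text \<open>Not a cumulative return: the expected reward collected at time \<open>t\<close> alone,
  undiscounted.\<close>

definition "return_at t s = (\<integral>s'. mean_reward s' \<partial>state_law M \<pi> t s g)"

lemma return_at_measurable[measurable]: "return_at t \<in> borel_measurable \<S>"
  unfolding return_at_def[abs_def]
  by (rule measurable_compose[OF measurable_prob_algebraD[OF state_law_measurable_goal]
          integral_measurable_subprob_algebra[OF mean_reward_measurable]])

lemma abs_return_at_le: "s \<in> space \<S> \<Longrightarrow> \<bar>return_at t s\<bar> \<le> R"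
  unfolding return_at_def
  by (intro abs_integral_le_prob_algebra[OF state_law_in_space] mean_reward_measurable abs_mean_reward_le)

lemma return_at_0: "s \<in> space \<S> \<Longrightarrow> return_at 0 s = mean_reward s"
  by (simp add: return_at_def integral_return)

lemma V_eq:
  assumes s: "s \<in> space \<S>"
  shows "V M \<pi> s g = (\<Sum>t. \<gamma> ^ t * return_at t s)"
proof -
  have m: "(\<lambda>\<omega>. reward M (fst (\<omega> t)) (snd (\<omega> t)) g) \<in> borel_measurable (\<Pi>\<^sub>M i\<in>(UNIV :: nat set). \<S> \<Otimes>\<^sub>M \<A>)" for t
    using measurable_compose[OF measurable_component_singleton[of t UNIV "\<lambda>_. \<S> \<Otimes>\<^sub>M \<A>"] reward_measurable_goal]
    by (simp add: case_prod_beta')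
  have "V M \<pi> s g = (\<Sum>t. \<gamma> ^ t * (\<integral>\<omega>. reward M (fst (\<omega> t)) (snd (\<omega> t)) g \<partial>trajectory M \<pi> s g))"
    unfolding V_def
  proof (rule integral_suminf_discounted[OF trajectory_in_space[OF s] discount m])
    fix \<omega> :: "nat \<Rightarrow> 's \<times> 'a" and t assume "\<omega> \<in> space (\<Pi>\<^sub>M i\<in>UNIV. \<S> \<Otimes>\<^sub>M \<A>)"
    then have "\<omega> t \<in> space (\<S> \<Otimes>\<^sub>M \<A>)" by (auto simp: space_PiM)
    then show "\<bar>reward M (fst (\<omega> t)) (snd (\<omega> t)) g\<bar> \<le> R"
      using goal by (intro abs_reward_le) (auto simp: space_pair_measure)
  qed
  moreover have "(\<integral>\<omega>. reward M (fst (\<omega> t)) (snd (\<omega> t)) g \<partial>trajectory M \<pi> s g) = return_at t s" for t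
    using integral_trajectory[OF s reward_measurable_goal, of R t] goal abs_reward_le
    by (simp add: case_prod_beta' return_at_def mean_reward_def space_pair_measure mem_Times_iff)
  ultimately show ?thesis by simp
qed

text \<open>\<open>state_law\<close> appends new steps at the end, whereas the Bellman equation
  conditions on the first step. Associativity of bind moves the extra step to the front.\<close>

lemma state_law_Suc_left:
  assumes s: "s \<in> space \<S>"
  shows "state_law M \<pi> (Suc t) s g = move M \<pi> s g \<bind> (\<lambda>s. state_law M \<pi> t s g)"
proof (induction t)
  case 0
  have "move M \<pi> s g \<in> space (prob_algebra \<S>)" by (rule measurable_space[OF move_measurable_goal s])
  then show ?case
    using kernel_return_bind[OF move_measurable_goal s] by (simp add: bind_return'' space_prob_algebra)
next
  case (Suc t)
  have mv: "move M \<pi> s g \<in> space (prob_algebra \<S>)" by (rule measurable_space[OF move_measurable_goal s])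
  have "state_law M \<pi> (Suc (Suc t)) s g
      = (move M \<pi> s g \<bind> (\<lambda>s. state_law M \<pi> t s g)) \<bind> (\<lambda>s. move M \<pi> s g)"
    using Suc by simp
  also have "\<dots> = move M \<pi> s g \<bind> (\<lambda>s. state_law M \<pi> (Suc t) s g)"
    using kernel_bind_assoc[OF mv state_law_measurable_goal move_measurable_goal] by simp
  finally show ?case .
qed

lemma return_at_Suc:
  assumes s: "s \<in> space \<S>"
  shows "return_at (Suc t) s = (\<integral>s'. return_at t s' \<partial>move M \<pi> s g)"
  unfolding return_at_def state_law_Suc_left[OF s]
  by (rule integral_bind_prob_algebra[OF measurable_space[OF move_measurable_goal s]
        state_law_measurable_goal mean_reward_measurable abs_mean_reward_le])

lemma V_measurable_goal[measurable]: "(\<lambda>s. V M \<pi> s g) \<in> borel_measurable \<S>"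
proof -
  have "(\<lambda>s. \<Sum>t. \<gamma> ^ t * return_at t s) \<in> borel_measurable \<S>" by measurable
  then show ?thesis by (simp add: V_eq cong: measurable_cong)
qed

lemma abs_V_le: "s \<in> space \<S> \<Longrightarrow> \<bar>V M \<pi> s g\<bar> \<le> R / (1 - \<gamma>)"
  unfolding V_eq by (intro abs_suminf_discounted_le discount abs_return_at_le)

lemma V_Bellman:
  assumes s: "s \<in> space \<S>"
  shows "V M \<pi> s g = mean_reward s + \<gamma> * (\<integral>s'. V M \<pi> s' g \<partial>move M \<pi> s g)"
proof -
  have mv: "move M \<pi> s g \<in> space (prob_algebra \<S>)" by (rule measurable_space[OF move_measurable_goal s])
  have sm: "summable (\<lambda>t. \<gamma> ^ t * return_at t s)"
    by (intro summable_discounted[OF discount, where B=R] abs_return_at_le s)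
  have "(\<integral>s'. V M \<pi> s' g \<partial>move M \<pi> s g) = (\<integral>s'. (\<Sum>t. \<gamma> ^ t * return_at t s') \<partial>move M \<pi> s g)"
    using space_of_prob_algebra[OF mv] by (intro Bochner_Integration.integral_cong) (auto simp: V_eq)
  also have "\<dots> = (\<Sum>t. \<gamma> ^ t * return_at (Suc t) s)"
    unfolding return_at_Suc[OF s]
    by (rule integral_suminf_discounted[OF mv discount return_at_measurable abs_return_at_le])
  also have "\<gamma> * \<dots> = (\<Sum>t. \<gamma> ^ Suc t * return_at (Suc t) s)"
    using summable_discounted[OF discount, of "\<lambda>t. return_at (Suc t) s" R] abs_return_at_le[OF s]
    by (subst suminf_mult[symmetric]) (auto simp: mult_ac)
  also have "mean_reward s + \<dots> = (\<Sum>t. \<gamma> ^ t * return_at t s)"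
    using suminf_split_head[OF sm] return_at_0[OF s] by simp
  finally show ?thesis using V_eq[OF s] by simp
qed

lemma integral_move:
  fixes h :: "'s \<Rightarrow> real"
  assumes s: "s \<in> space \<S>" and h: "h \<in> borel_measurable \<S>" and B: "\<And>s. s \<in> space \<S> \<Longrightarrow> \<bar>h s\<bar> \<le> B"
  shows "(\<integral>s'. h s' \<partial>move M \<pi> s g) = (\<integral>a. \<integral>s'. h s' \<partial>trans M s a \<partial>\<pi> s g)"
  unfolding move_def
  by (rule integral_bind_prob_algebra[OF policy_in_space[OF s] trans_measurable_state[OF s] h B])

end

section \<open>Comparing two policies in one step and over the whole horizon\<close>

context gamdp
begin

lemma integral_policy_diff_le:
  fixes h :: "'a \<Rightarrow> real"
  assumes "is_policy M \<pi>\<^sub>1" "is_policy M \<pi>\<^sub>2" "s \<in> space \<S>" "g \<in> space \<G>"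
    and h: "h \<in> borel_measurable \<A>" and B: "\<And>a. a \<in> space \<A> \<Longrightarrow> \<bar>h a\<bar> \<le> B"
  shows "(\<integral>a. h a \<partial>\<pi>\<^sub>1 s g) - (\<integral>a. h a \<partial>\<pi>\<^sub>2 s g) \<le> 2 * B * D_TV M \<pi>\<^sub>1 \<pi>\<^sub>2 s g"
proof -
  interpret P1: gamdp_policy M \<pi>\<^sub>1 g using assms by unfold_locales
  interpret P2: gamdp_policy M \<pi>\<^sub>2 g using assms by unfold_locales
  \<comment> \<open>The values of \<open>h\<close> lie in an interval of length
    \<open>2 * B\<close>; this is the source of the leading 2 in the final bound.\<close>
  have "(\<integral>a. h a \<partial>\<pi>\<^sub>1 s g) - (\<integral>a. h a \<partial>\<pi>\<^sub>2 s g) \<le> (B - (- B)) * sup_diff \<A> (\<pi>\<^sub>1 s g) (\<pi>\<^sub>2 s g)"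
    using B by (intro integral_diff_le_sup_diff P1.policy_in_space P2.policy_in_space assms h)
      (auto simp: abs_le_iff minus_le_iff)
  then show ?thesis by (simp add: D_TV_def)
qed

lemma D_TV_bounds:
  assumes "is_policy M \<pi>\<^sub>1" "is_policy M \<pi>\<^sub>2" "s \<in> space \<S>" "g \<in> space \<G>"
  shows "0 \<le> D_TV M \<pi>\<^sub>1 \<pi>\<^sub>2 s g" "D_TV M \<pi>\<^sub>1 \<pi>\<^sub>2 s g \<le> 1"
proof -
  interpret P1: gamdp_policy M \<pi>\<^sub>1 g using assms by unfold_locales
  interpret P2: gamdp_policy M \<pi>\<^sub>2 g using assms by unfold_locales
  show "0 \<le> D_TV M \<pi>\<^sub>1 \<pi>\<^sub>2 s g" "D_TV M \<pi>\<^sub>1 \<pi>\<^sub>2 s g \<le> 1"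
    unfolding D_TV_def using P1.policy_in_space[OF assms(3)] P2.policy_in_space[OF assms(3)]
    by (auto intro!: sup_diff_nonneg sup_diff_le_1 simp: space_prob_algebra)
qed

text \<open>Both summands have the intermediate policy in first position, using symmetry once,
  because the surrogate expert stands there in both discrepancies of the final bound.\<close>

lemma D_TV_triangle:
  assumes "is_policy M \<pi>\<^sub>1" "is_policy M \<pi>\<^sub>2" "is_policy M \<pi>\<^sub>3" "s \<in> space \<S>" "g \<in> space \<G>"
  shows "D_TV M \<pi>\<^sub>1 \<pi>\<^sub>3 s g \<le> D_TV M \<pi>\<^sub>2 \<pi>\<^sub>1 s g + D_TV M \<pi>\<^sub>2 \<pi>\<^sub>3 s g"
proof -
  interpret P1: gamdp_policy M \<pi>\<^sub>1 g using assms by unfold_locales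
  interpret P2: gamdp_policy M \<pi>\<^sub>2 g using assms by unfold_locales
  interpret P3: gamdp_policy M \<pi>\<^sub>3 g using assms by unfold_locales
  show ?thesis
    unfolding D_TV_def sup_diff_commute[of \<A> "\<pi>\<^sub>2 s g" "\<pi>\<^sub>1 s g"]
    using P1.policy_in_space[OF assms(4)] P2.policy_in_space[OF assms(4)] P3.policy_in_space[OF assms(4)]
    by (intro sup_diff_triangle) (auto simp: space_prob_algebra)
qed

text \<open>The countable generation demanded by \<open>is_gamdp\<close> enters here.\<close>

lemma D_TV_measurable:
  assumes "is_policy M \<pi>\<^sub>1" "is_policy M \<pi>\<^sub>2"
  shows "(\<lambda>(s, g). D_TV M \<pi>\<^sub>1 \<pi>\<^sub>2 s g) \<in> borel_measurable (\<S> \<Otimes>\<^sub>M \<G>)"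
  using measurable_sup_diff[OF _ policy_measurable[OF assms(1)] policy_measurable[OF assms(2)]] gamdp
  by (simp add: is_gamdp_def D_TV_def case_prod_beta')

text \<open>The roles are crossed on purpose: states follow the expert while the value function
  belongs to \<open>\<pi>\<close>. This pairing weights the one-step errors by the expert's
  occupancy, the law that \<open>visit_dist\<close> uses.\<close>

lemma V_diff_le:
  assumes \<pi>\<^sub>E: "is_policy M \<pi>\<^sub>E" and \<pi>: "is_policy M \<pi>" and s0: "s\<^sub>0 \<in> space \<S>" and g: "g \<in> space \<G>"
  shows "V M \<pi>\<^sub>E s\<^sub>0 g - V M \<pi> s\<^sub>0 g \<le>
    2 * R / (1 - \<gamma>)^2 * (\<integral>s. D_TV M \<pi>\<^sub>E \<pi> s g \<partial>occupancy M \<pi>\<^sub>E s\<^sub>0 g)"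
proof -
  interpret E: gamdp_policy M \<pi>\<^sub>E g using assms by unfold_locales
  interpret P: gamdp_policy M \<pi> g using assms by unfold_locales
  define W where "W = (\<lambda>s. V M \<pi> s g)"
  define \<mu> where "\<mu> = (\<lambda>t. state_law M \<pi>\<^sub>E t s\<^sub>0 g)"
  define C where "C = R / (1 - \<gamma>)"
  define T where "T = (\<lambda>s. D_TV M \<pi>\<^sub>E \<pi> s g)"
  define D where "D t = (\<integral>s. W s \<partial>\<mu> t)" for t
  have \<mu>: "\<mu> t \<in> space (prob_algebra \<S>)" for t unfolding \<mu>_def by (rule E.state_law_in_space[OF s0])
  have W[measurable]: "W \<in> borel_measurable \<S>" unfolding W_def by measurable
  have WC: "\<bar>W s\<bar> \<le> C" if "s \<in> space \<S>" for s unfolding W_def C_def by (rule P.abs_V_le[OF that])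
  have T[measurable]: "T \<in> borel_measurable \<S>"
    unfolding T_def using measurable_Pair_right[OF D_TV_measurable[OF \<pi>\<^sub>E \<pi>] g] by simp
  have T1: "\<bar>T s\<bar> \<le> 1" if "s \<in> space \<S>" for s
    unfolding T_def using D_TV_bounds[OF \<pi>\<^sub>E \<pi> that g] by simp
  have DC: "\<bar>D t\<bar> \<le> C" for t
    unfolding D_def by (intro abs_integral_le_prob_algebra[OF \<mu> W WC])
  have PW: "(\<lambda>s. \<integral>s'. W s' \<partial>move M \<pi>\<^sub>E s g) \<in> borel_measurable \<S>"
    by (rule measurable_compose[OF measurable_prob_algebraD[OF E.move_measurable_goal]
          integral_measurable_subprob_algebra[OF W]])
  have PWC: "\<bar>\<integral>s'. W s' \<partial>move M \<pi>\<^sub>E s g\<bar> \<le> C" if "s \<in> space \<S>" for s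
    by (rule abs_integral_le_prob_algebra[OF measurable_space[OF E.move_measurable_goal that] W WC])
  have D_Suc: "D (Suc t) = (\<integral>s. \<integral>s'. W s' \<partial>move M \<pi>\<^sub>E s g \<partial>\<mu> t)" for t
    unfolding D_def using integral_bind_prob_algebra[OF \<mu> E.move_measurable_goal W WC, of t]
    by (simp add: \<mu>_def)
  \<comment> \<open>The left side is the mean of \<open>Q\<close> under \<open>\<pi>\<^sub>E\<close>
    minus its mean under \<open>\<pi>\<close>, the latter being \<open>W s\<close> by the Bellman
    equation of \<open>\<pi>\<close>. So one function of the action is integrated against two action
    laws.\<close>
  have pointwise: "E.mean_reward s + \<gamma> * (\<integral>s'. W s' \<partial>move M \<pi>\<^sub>E s g) - W s \<le> 2 * C * T s"
    if s: "s \<in> space \<S>" for s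
  proof -
    define Q where "Q = (\<lambda>a. reward M s a g + \<gamma> * (\<integral>s'. W s' \<partial>trans M s a))"
    have rw: "(\<lambda>a. reward M s a g) \<in> borel_measurable \<A>" by (rule P.reward_measurable_action[OF s])
    have tw: "(\<lambda>a. \<integral>s'. W s' \<partial>trans M s a) \<in> borel_measurable \<A>"
      by (rule measurable_compose[OF measurable_prob_algebraD[OF P.trans_measurable_state[OF s]]
            integral_measurable_subprob_algebra[OF W]])
    have rB: "\<bar>reward M s a g\<bar> \<le> R" if "a \<in> space \<A>" for a using s that g by (rule abs_reward_le)
    have tB: "\<bar>\<integral>s'. W s' \<partial>trans M s a\<bar> \<le> C" if "a \<in> space \<A>" for a
      by (rule abs_integral_le_prob_algebra[OF P.trans_in_space[OF s that] W WC])
    \<comment> \<open>The bound reproduces itself, \<open>R + \<gamma> * C = C\<close>, so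
      \<open>Q\<close> obeys the same bound as the value function.\<close>
    have QB: "\<bar>Q a\<bar> \<le> C" if "a \<in> space \<A>" for a
    proof -
      have "\<bar>Q a\<bar> \<le> \<bar>reward M s a g\<bar> + \<gamma> * \<bar>\<integral>s'. W s' \<partial>trans M s a\<bar>"
        unfolding Q_def using abs_triangle_ineq[of "reward M s a g" "\<gamma> * (\<integral>s'. W s' \<partial>trans M s a)"] discount
        by (simp add: abs_mult)
      also have "\<dots> \<le> R + \<gamma> * C"
        using rB[OF that] tB[OF that] discount by (intro add_mono mult_left_mono)
      also have "\<dots> = C" using discount by (simp add: C_def field_simps)
      finally show ?thesis .
    qed
    have intQ: "(\<integral>a. Q a \<partial>\<rho>) = (\<integral>a. reward M s a g \<partial>\<rho>) + \<gamma> * (\<integral>a. \<integral>s'. W s' \<partial>trans M s a \<partial>\<rho>)"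
      if "\<rho> \<in> space (prob_algebra \<A>)" for \<rho>
      unfolding Q_def using integrable_bounded_prob_algebra[OF that rw rB] integrable_bounded_prob_algebra[OF that tw tB]
      by simp
    have "(\<integral>a. Q a \<partial>\<pi>\<^sub>E s g) - (\<integral>a. Q a \<partial>\<pi> s g) \<le> 2 * C * T s"
      unfolding T_def using QB rw tw
      by (intro integral_policy_diff_le[OF \<pi>\<^sub>E \<pi> s g]) (auto simp: Q_def)
    moreover have "(\<integral>a. Q a \<partial>\<pi>\<^sub>E s g) = E.mean_reward s + \<gamma> * (\<integral>s'. W s' \<partial>move M \<pi>\<^sub>E s g)"
      by (simp add: intQ[OF E.policy_in_space[OF s]] E.mean_reward_def E.integral_move[OF s W WC])
    moreover have "W s = P.mean_reward s + \<gamma> * (\<integral>s'. W s' \<partial>move M \<pi> s g)"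
      unfolding W_def by (rule P.V_Bellman[OF s])
    then have "(\<integral>a. Q a \<partial>\<pi> s g) = W s"
      by (simp add: intQ[OF P.policy_in_space[OF s]] P.mean_reward_def P.integral_move[OF s W WC])
    ultimately show ?thesis by simp
  qed
  define \<tau> where "\<tau> = (\<lambda>t. \<integral>s. T s \<partial>\<mu> t)"
  have \<tau>1: "\<bar>\<tau> t\<bar> \<le> 1" for t
    unfolding \<tau>_def by (intro abs_integral_le_prob_algebra[OF \<mu> T T1])
  \<comment> \<open>This is \<open>pointwise\<close> averaged over the expert's state law at time
    \<open>t\<close>: the integral over the expert's move becomes \<open>D (Suc t)\<close>.\<close>
  have step: "E.return_at t s\<^sub>0 \<le> D t - \<gamma> * D (Suc t) + 2 * C * \<tau> t" for t
  proof -
    note int = integrable_bounded_prob_algebra[OF \<mu>[of t]]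
    note ints = int[OF E.mean_reward_measurable E.abs_mean_reward_le] int[OF PW PWC] int[OF W WC] int[OF T T1]
    have "(\<integral>s. E.mean_reward s + \<gamma> * (\<integral>s'. W s' \<partial>move M \<pi>\<^sub>E s g) - W s \<partial>\<mu> t) \<le> (\<integral>s. 2 * C * T s \<partial>\<mu> t)"
      using ints pointwise space_of_prob_algebra[OF \<mu>] by (intro integral_mono) auto
    moreover have "E.return_at t s\<^sub>0 = (\<integral>s. E.mean_reward s \<partial>\<mu> t)"
      by (simp add: E.return_at_def \<mu>_def)
    ultimately show ?thesis
      using ints by (simp add: D_Suc \<tau>_def D_def[of t])
  qed
  \<comment> \<open>Since \<open>D\<close> is bounded, the boundary term at infinity vanishes and
    telescoping leaves only \<open>D 0\<close>, the value of \<open>\<pi>\<close> at the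
    start.\<close>
  have "(\<lambda>t. \<gamma> ^ t * D t) \<longlonglongrightarrow> 0"
    by (rule summable_LIMSEQ_zero[OF summable_discounted[OF discount DC]])
  from telescope_sums'[OF this] have tele: "(\<lambda>t. \<gamma> ^ t * D t - \<gamma> ^ Suc t * D (Suc t)) sums D 0"
    by simp
  have \<tau>s: "(\<lambda>t. 2 * C * (\<gamma> ^ t * \<tau> t)) sums (2 * C * (\<Sum>t. \<gamma> ^ t * \<tau> t))"
    by (intro sums_mult summable_sums summable_discounted[OF discount \<tau>1])
  have "V M \<pi>\<^sub>E s\<^sub>0 g = (\<Sum>t. \<gamma> ^ t * E.return_at t s\<^sub>0)" by (rule E.V_eq[OF s0])
  also have "\<dots> \<le> (\<Sum>t. \<gamma> ^ t * D t - \<gamma> ^ Suc t * D (Suc t) + 2 * C * (\<gamma> ^ t * \<tau> t))"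
  proof (rule suminf_le)
    fix t
    have "\<gamma> ^ t * E.return_at t s\<^sub>0 \<le> \<gamma> ^ t * (D t - \<gamma> * D (Suc t) + 2 * C * \<tau> t)"
      using step discount by (intro mult_left_mono) auto
    then show "\<gamma> ^ t * E.return_at t s\<^sub>0 \<le> \<gamma> ^ t * D t - \<gamma> ^ Suc t * D (Suc t) + 2 * C * (\<gamma> ^ t * \<tau> t)"
      by (simp add: algebra_simps)
  qed (use sums_add[OF tele \<tau>s] summable_discounted[OF discount E.abs_return_at_le[OF s0]] in
        \<open>auto simp: sums_iff\<close>)
  also have "\<dots> = D 0 + 2 * C * (\<Sum>t. \<gamma> ^ t * \<tau> t)"
    using sums_add[OF tele \<tau>s] by (simp add: sums_iff)
  also have "D 0 = V M \<pi> s\<^sub>0 g"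
    using s0 by (simp add: D_def \<mu>_def W_def integral_return)
  \<comment> \<open>The occupancy carries the normalization \<open>1 - \<gamma>\<close>; dividing by
    it produces the second factor \<open>1 / (1 - \<gamma>)\<close>.\<close>
  also have "(\<Sum>t. \<gamma> ^ t * \<tau> t) = (\<integral>s. T s \<partial>occupancy M \<pi>\<^sub>E s\<^sub>0 g) / (1 - \<gamma>)"
    using E.integral_occupancy[OF s0 T T1] discount by (simp add: \<tau>_def \<mu>_def)
  finally show ?thesis by (simp add: C_def T_def power2_eq_square)
qed

end

subsection \<open>Generalization from samples\<close>

text \<open>Independence means that the joint law is the product of the marginals. Restricting to
  \<open>I\<close> is the identity on extensional functions, so the joint law is the product measure
  itself, and each marginal is \<open>M\<close>.\<close>

lemma (in prob_space) indep_vars_coordinates: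
  assumes "finite I" "I \<noteq> {}"
  shows "prob_space.indep_vars (\<Pi>\<^sub>M i\<in>I. M) (\<lambda>_. M) (\<lambda>i \<omega>. \<omega> i) I"
proof -
  interpret P: prob_space "\<Pi>\<^sub>M i\<in>I. M" by (intro prob_space_PiM prob_space_axioms)
  have "distr (\<Pi>\<^sub>M i\<in>I. M) (\<Pi>\<^sub>M i\<in>I. M) (\<lambda>\<omega>. \<lambda>i\<in>I. \<omega> i)
      = distr (\<Pi>\<^sub>M i\<in>I. M) (\<Pi>\<^sub>M i\<in>I. M) (\<lambda>\<omega>. \<omega>)"
    by (intro distr_cong refl) (auto simp: space_PiM PiE_iff extensional_restrict)
  also have "\<dots> = (\<Pi>\<^sub>M i\<in>I. M)" by simp
  also have "\<dots> = (\<Pi>\<^sub>M i\<in>I. distr (\<Pi>\<^sub>M i\<in>I. M) M (\<lambda>\<omega>. \<omega> i))"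
    using assms by (intro PiM_cong refl distr_PiM_component[symmetric] prob_space_axioms) auto
  finally show ?thesis
    using assms by (subst P.indep_vars_iff_distr_eq_PiM') auto
qed

text \<open>A deviation \<open>\<epsilon>\<close> of the mean is a deviation
  \<open>m * \<epsilon>\<close> of a sum of \<open>m\<close> terms with range of length 1, which
  reduces the exponent \<open>-2 (m \<epsilon>)^2 / m\<close> to the stated one.\<close>

lemma (in prob_space) Hoeffding_sample_mean:
  fixes h :: "'a \<Rightarrow> real"
  assumes h[measurable]: "h \<in> borel_measurable M" and h01: "\<And>x. x \<in> space M \<Longrightarrow> h x \<in> {0..1}"
    and "1 \<le> m" "0 \<le> \<epsilon>"
  shows "\<P>(z in (\<Pi>\<^sub>M i\<in>{..<m}. M). (\<Sum>i<m. h (z i)) / real m \<le> expectation h - \<epsilon>)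
    \<le> exp (- 2 * real m * \<epsilon>\<^sup>2)"
proof -
  let ?P = "\<Pi>\<^sub>M i\<in>{..<m}. M"
  interpret P: prob_space ?P by (intro prob_space_PiM prob_space_axioms)
  have E: "P.expectation (\<lambda>z. h (z i)) = expectation h" if "i < m" for i
  proof -
    have "P.expectation (\<lambda>z. h (z i)) = (\<integral>x. h x \<partial>distr ?P M (\<lambda>z. z i))"
      using that by (subst integral_distr) auto
    also have "distr ?P M (\<lambda>z. z i) = M"
      using that by (intro distr_PiM_component prob_space_axioms) auto
    finally show ?thesis .
  qed
  interpret H: Hoeffding_ineq ?P "{..<m}" "\<lambda>i z. h (z i)" "\<lambda>_. 0" "\<lambda>_. 1" "real m * expectation h"
  proof unfold_locales
    show "P.indep_vars (\<lambda>_. borel) (\<lambda>i z. h (z i)) {..<m}"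
      using \<open>1 \<le> m\<close>
      by (intro P.indep_vars_compose2[OF indep_vars_coordinates]) (auto simp: lessThan_empty_iff)
    show "AE z in ?P. h (z i) \<in> {0..1}" if "i \<in> {..<m}" for i
      using that h01 by (intro AE_I2) (auto simp: space_PiM PiE_iff)
    show "real m * expectation h \<equiv> \<Sum>i<m. P.expectation (\<lambda>z. h (z i))"
      by (simp add: E)
  qed simp
  have "\<P>(z in ?P. (\<Sum>i<m. h (z i)) / real m \<le> expectation h - \<epsilon>)
      = P.prob {z \<in> space ?P. (\<Sum>i<m. h (z i)) \<le> real m * expectation h - real m * \<epsilon>}"
    using \<open>1 \<le> m\<close> by (simp add: field_simps)
  also have "\<dots> \<le> exp (- 2 * (real m * \<epsilon>)\<^sup>2 / (\<Sum>i<m. (1 - 0)\<^sup>2))"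
    using \<open>1 \<le> m\<close> \<open>0 \<le> \<epsilon>\<close> by (intro H.Hoeffding_ineq_le) auto
  also have "- 2 * (real m * \<epsilon>)\<^sup>2 / (\<Sum>i<m. (1 - 0)\<^sup>2) = - 2 * real m * \<epsilon>\<^sup>2"
    using \<open>1 \<le> m\<close> by (simp add: power2_eq_square)
  finally show ?thesis .
qed

text \<open>Only an empirical mean that is too small does harm, so the union bound runs over one
  one-sided event for each member of \<open>H\<close>. Each has probability at most
  \<open>\<delta> / (2 * card H)\<close>, together at most half of \<open>\<delta>\<close>.\<close>

lemma (in prob_space) uniform_Hoeffding:
  fixes h :: "'k \<Rightarrow> 'a \<Rightarrow> real"
  assumes "finite H" and h[measurable]: "\<And>k. k \<in> H \<Longrightarrow> h k \<in> borel_measurable M"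
    and h01: "\<And>k x. k \<in> H \<Longrightarrow> x \<in> space M \<Longrightarrow> h k x \<in> {0..1}"
    and "1 \<le> m" "0 < \<delta>" "\<delta> < 1"
  shows "1 - \<delta> \<le> \<P>(z in (\<Pi>\<^sub>M i\<in>{..<m}. M). \<forall>k\<in>H. expectation (h k) \<le>
    (\<Sum>i<m. h k (z i)) / real m + sqrt ((ln (2 * real (card H)) + ln (1 / \<delta>)) / (2 * real m)))"
proof (cases "H = {}")
  \<comment> \<open>With no hypothesis the event is the whole sample space. Otherwise
    \<open>card H\<close> is at least 1, which makes the radicand nonnegative, so that squaring
    \<open>\<epsilon>\<close> recovers it.\<close>
  case True
  interpret P: prob_space "\<Pi>\<^sub>M i\<in>{..<m}. M" by (intro prob_space_PiM prob_space_axioms)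
  show ?thesis using True \<open>0 < \<delta>\<close> by (simp add: P.prob_space)
next
  case False
  let ?P = "\<Pi>\<^sub>M i\<in>{..<m}. M"
  interpret P: prob_space ?P by (intro prob_space_PiM prob_space_axioms)
  define \<epsilon> where "\<epsilon> = sqrt ((ln (2 * real (card H)) + ln (1 / \<delta>)) / (2 * real m))"
  define bad where "bad = (\<lambda>k. {z \<in> space ?P. (\<Sum>i<m. h k (z i)) / real m \<le> expectation (h k) - \<epsilon>})"
  have n: "1 \<le> real (card H)"
    using False \<open>finite H\<close> by (simp add: Suc_le_eq card_gt_0_iff)
  have l: "0 \<le> ln (2 * real (card H)) + ln (1 / \<delta>)"
    using n \<open>0 < \<delta>\<close> \<open>\<delta> < 1\<close> by (intro add_nonneg_nonneg ln_ge_zero) auto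
  have e2: "- 2 * real m * \<epsilon>\<^sup>2 = - (ln (2 * real (card H)) + ln (1 / \<delta>))"
    using l \<open>1 \<le> m\<close> by (simp add: \<epsilon>_def)
  \<comment> \<open>\<open>\<epsilon>\<close> is the solution of this equation.\<close>
  have "exp (- 2 * real m * \<epsilon>\<^sup>2) = \<delta> / (2 * real (card H))"
    unfolding e2 using n \<open>0 < \<delta>\<close> by (simp add: exp_minus exp_add exp_diff ln_div field_simps)
  then have bad: "P.prob (bad k) \<le> \<delta> / (2 * real (card H))" if "k \<in> H" for k
    using Hoeffding_sample_mean[OF h[OF that] h01[OF that] \<open>1 \<le> m\<close>, of \<epsilon>] l \<open>1 \<le> m\<close>
    by (simp add: bad_def \<epsilon>_def)
  have bad_sets: "bad k \<in> sets ?P" if "k \<in> H" for k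
    unfolding bad_def using h[OF that] by measurable
  have "P.prob (\<Union>k\<in>H. bad k) \<le> (\<Sum>k\<in>H. P.prob (bad k))"
    using bad_sets \<open>finite H\<close> by (intro measure_UNION_le) auto
  also have "\<dots> \<le> (\<Sum>k\<in>H. \<delta> / (2 * real (card H)))" by (intro sum_mono bad)
  also have "\<dots> \<le> \<delta>" using n \<open>0 < \<delta>\<close> by simp
  finally have "1 - \<delta> \<le> P.prob (space ?P - (\<Union>k\<in>H. bad k))"
    using bad_sets \<open>finite H\<close> by (subst P.prob_compl) auto
  also have "\<dots> \<le> \<P>(z in ?P. \<forall>k\<in>H. expectation (h k) \<le> (\<Sum>i<m. h k (z i)) / real m + \<epsilon>)"
  proof (rule P.finite_measure_mono)
    show "{z \<in> space ?P. \<forall>k\<in>H. expectation (h k) \<le> (\<Sum>i<m. h k (z i)) / real m + \<epsilon>} \<in> sets ?P"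
      using \<open>finite H\<close> by measurable
  qed (auto simp: bad_def not_le)
  finally show ?thesis by (simp only: \<epsilon>_def)
qed

section \<open>Transfer from the testing to the training distribution\<close>

context gamdp
begin

lemma visit_kernel_measurable:
  assumes "is_policy M \<pi>"
  shows "(\<lambda>(s\<^sub>0, g). occupancy M \<pi> s\<^sub>0 g \<bind> (\<lambda>s. return (inputs M) (s, g))) \<in> inputs M \<rightarrow>\<^sub>M prob_algebra (inputs M)"
proof -
  note [measurable] = occupancy_measurable[OF assms]
  have "(\<lambda>x. (case x of (s, g) \<Rightarrow> occupancy M \<pi> s g) \<bind> (\<lambda>s. return (inputs M) (s, snd x)))
      \<in> inputs M \<rightarrow>\<^sub>M prob_algebra (inputs M)"
    by (intro measurable_bind_prob_space2[where N=\<S>]) measurable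
  then show ?thesis by (simp add: case_prod_beta')
qed

lemma visit_dist_in_space:
  assumes "is_policy M \<pi>" "\<rho> \<in> space (prob_algebra (inputs M))"
  shows "visit_dist M \<pi> \<rho> \<in> space (prob_algebra (inputs M))"
  unfolding visit_dist_def by (rule bind_in_space_prob_algebra[OF assms(2) visit_kernel_measurable[OF assms(1)]])

lemma integral_visit_kernel:
  fixes h :: "'s \<times> 'g \<Rightarrow> real"
  assumes \<pi>: "is_policy M \<pi>" and h: "h \<in> borel_measurable (inputs M)"
    and B: "\<And>x. x \<in> space (inputs M) \<Longrightarrow> \<bar>h x\<bar> \<le> B"
    and s: "s\<^sub>0 \<in> space \<S>" and g: "g \<in> space \<G>"
  shows "(\<integral>x. h x \<partial>(occupancy M \<pi> s\<^sub>0 g \<bind> (\<lambda>s. return (inputs M) (s, g))))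
    = (\<integral>s. h (s, g) \<partial>occupancy M \<pi> s\<^sub>0 g)"
proof -
  interpret gamdp_policy M \<pi> g using assms by unfold_locales
  have "(\<integral>x. h x \<partial>(occupancy M \<pi> s\<^sub>0 g \<bind> (\<lambda>s. return (inputs M) (s, g))))
    = (\<integral>s. \<integral>x. h x \<partial>return (inputs M) (s, g) \<partial>occupancy M \<pi> s\<^sub>0 g)"
    by (rule integral_bind_prob_algebra[OF occupancy_in_space[OF s] _ h B]) (use g in measurable)
  also have "\<dots> = (\<integral>s. h (s, g) \<partial>occupancy M \<pi> s\<^sub>0 g)"
    using g h space_of_prob_algebra[OF occupancy_in_space[OF s]]
    by (intro Bochner_Integration.integral_cong refl integral_return) (auto simp: space_pair_measure)
  finally show ?thesis .
qed

text \<open>The pointwise value gap is at most a constant times \<open>F\<close>, a function of the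
  start pair alone. Its mean over \<open>PS\<close> is the discrepancy, so the two domains need to
  be compared only as laws of start pairs, not as laws of visited states.\<close>

lemma SubOpt_le:
  assumes \<pi>\<^sub>E: "is_policy M \<pi>\<^sub>E" and \<pi>: "is_policy M \<pi>"
    and PS: "PS \<in> space (prob_algebra (inputs M))" and PT: "PT \<in> space (prob_algebra (inputs M))"
  shows "SubOpt M PT \<pi>\<^sub>E \<pi> \<le>
    2 * R / (1 - \<gamma>)^2 * (discrepancy M \<pi>\<^sub>E PS \<pi>\<^sub>E \<pi> + sup_diff (inputs M) PT PS)"
proof -
  define c where "c = 2 * R / (1 - \<gamma>)^2"
  define h where "h = (\<lambda>(s, g). D_TV M \<pi>\<^sub>E \<pi> s g)"
  \<comment> \<open>This kernel is common to both domains because dynamics and expert are; only the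
    law of its input changes.\<close>
  define \<kappa> where "\<kappa> = (\<lambda>(s\<^sub>0, g). occupancy M \<pi>\<^sub>E s\<^sub>0 g \<bind> (\<lambda>s. return (inputs M) (s, g)))"
  define F where "F = (\<lambda>x. \<integral>y. h y \<partial>\<kappa> x)"
  have h: "h \<in> borel_measurable (inputs M)" unfolding h_def by (rule D_TV_measurable[OF \<pi>\<^sub>E \<pi>])
  have h01: "0 \<le> h x" "\<bar>h x\<bar> \<le> 1" if "x \<in> space (inputs M)" for x
    using D_TV_bounds[OF \<pi>\<^sub>E \<pi>] that by (auto simp: h_def space_pair_measure)
  have \<kappa>: "\<kappa> \<in> inputs M \<rightarrow>\<^sub>M prob_algebra (inputs M)"
    unfolding \<kappa>_def by (rule visit_kernel_measurable[OF \<pi>\<^sub>E])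
  have F: "F \<in> borel_measurable (inputs M)"
    unfolding F_def by (rule measurable_compose[OF measurable_prob_algebraD[OF \<kappa>] integral_measurable_subprob_algebra[OF h]])
  have F0: "0 \<le> F x" if "x \<in> space (inputs M)" for x
    unfolding F_def using h01(1) space_of_prob_algebra[OF measurable_space[OF \<kappa> that]]
    by (intro Bochner_Integration.integral_nonneg) auto
  have F1: "\<bar>F x\<bar> \<le> 1" if "x \<in> space (inputs M)" for x
    unfolding F_def by (rule abs_integral_le_prob_algebra[OF measurable_space[OF \<kappa> that] h h01(2)])
  have PTs: "prob_space PT" "prob_space PS" using PT PS by (auto simp: space_prob_algebra)
  interpret PT: prob_space PT by fact
  \<comment> \<open>A probability measure has a nonempty space, so some start pair exists; there the
    mean reward of \<open>\<pi>\<close> is bounded by \<open>R\<close> in absolute value, whence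
    \<open>R\<close> is nonnegative.\<close>
  obtain s g where sg: "s \<in> space \<S>" "g \<in> space \<G>"
    using PT.not_empty space_of_prob_algebra[OF PT] by (auto simp: space_pair_measure)
  interpret P: gamdp_policy M \<pi> g using \<pi> sg by unfold_locales
  have "0 \<le> R" using P.abs_mean_reward_le[OF sg(1)] by linarith
  then have c: "0 \<le> c" by (simp add: c_def)
  have disc: "discrepancy M \<pi>\<^sub>E PS \<pi>\<^sub>E \<pi> = (\<integral>x. F x \<partial>PS)"
    unfolding F_def using integral_bind_prob_algebra[OF PS \<kappa> h h01(2)]
    by (simp add: discrepancy_def visit_dist_def \<kappa>_def h_def)
  \<comment> \<open>\<open>F\<close> has range of length 1, so the price is a single
    \<open>sup_diff\<close>, which is half of \<open>d1\<close>.\<close>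
  have shift: "(\<integral>x. F x \<partial>PT) \<le> (\<integral>x. F x \<partial>PS) + sup_diff (inputs M) PT PS"
    using integral_diff_le_sup_diff[OF PT PS F, of 0 1] F0 F1 by (simp add: abs_le_iff)
  have nn: "0 \<le> (\<integral>x. F x \<partial>PS) + sup_diff (inputs M) PT PS"
    using F0 space_of_prob_algebra[OF PS]
    by (intro add_nonneg_nonneg Bochner_Integration.integral_nonneg sup_diff_nonneg PTs) auto
  have "SubOpt M PT \<pi>\<^sub>E \<pi> \<le> c * ((\<integral>x. F x \<partial>PS) + sup_diff (inputs M) PT PS)"
  proof (cases "integrable PT (\<lambda>(s\<^sub>0, g). V M \<pi>\<^sub>E s\<^sub>0 g - V M \<pi> s\<^sub>0 g)")
    case True
    have "SubOpt M PT \<pi>\<^sub>E \<pi> \<le> (\<integral>x. c * F x \<partial>PT)"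
      unfolding SubOpt_def
    proof (rule integral_mono[OF True])
      show "integrable PT (\<lambda>x. c * F x)"
        using integrable_bounded_prob_algebra[OF PT F F1] by simp
      fix x assume "x \<in> space PT"
      then obtain s g where x: "x = (s, g)" and sg: "s \<in> space \<S>" "g \<in> space \<G>"
        using space_of_prob_algebra[OF PT] by (auto simp: space_pair_measure)
      show "(case x of (s\<^sub>0, g) \<Rightarrow> V M \<pi>\<^sub>E s\<^sub>0 g - V M \<pi> s\<^sub>0 g) \<le> c * F x"
        using V_diff_le[OF \<pi>\<^sub>E \<pi> sg] integral_visit_kernel[OF \<pi>\<^sub>E h h01(2) sg]
        by (simp add: x c_def F_def \<kappa>_def h_def)
    qed
    also have "\<dots> = c * (\<integral>x. F x \<partial>PT)" by simp
    also have "\<dots> \<le> c * ((\<integral>x. F x \<partial>PS) + sup_diff (inputs M) PT PS)"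
      by (rule mult_left_mono[OF shift c])
    finally show ?thesis .
  next
    case False
    \<comment> \<open>The Bochner integral is then 0 by convention, so measurability of \<open>V\<close> in the start pair is not needed.\<close>
    then show ?thesis using c nn by (simp add: SubOpt_def not_integrable_integral_eq)
  qed
  then show ?thesis unfolding c_def disc .
qed

lemma discrepancy_triangle:
  assumes "is_policy M \<pi>\<^sub>E" "is_policy M \<pi>\<^sub>1" "is_policy M \<pi>\<^sub>2" "is_policy M \<pi>\<^sub>3"
    and "\<rho> \<in> space (prob_algebra (inputs M))"
  shows "discrepancy M \<pi>\<^sub>E \<rho> \<pi>\<^sub>1 \<pi>\<^sub>3 \<le> discrepancy M \<pi>\<^sub>E \<rho> \<pi>\<^sub>2 \<pi>\<^sub>1 + discrepancy M \<pi>\<^sub>E \<rho> \<pi>\<^sub>2 \<pi>\<^sub>3"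
proof -
  note vd = visit_dist_in_space[OF assms(1,5)]
  have int: "integrable (visit_dist M \<pi>\<^sub>E \<rho>) (\<lambda>(s, g). D_TV M \<pi> \<pi>' s g)"
    if "is_policy M \<pi>" "is_policy M \<pi>'" for \<pi> \<pi>'
    using D_TV_bounds[OF that]
    by (intro integrable_bounded_prob_algebra[OF vd D_TV_measurable[OF that], where B=1])
      (auto simp: space_pair_measure)
  have "discrepancy M \<pi>\<^sub>E \<rho> \<pi>\<^sub>1 \<pi>\<^sub>3 \<le>
    (\<integral>x. (case x of (s, g) \<Rightarrow> D_TV M \<pi>\<^sub>2 \<pi>\<^sub>1 s g) + (case x of (s, g) \<Rightarrow> D_TV M \<pi>\<^sub>2 \<pi>\<^sub>3 s g) \<partial>visit_dist M \<pi>\<^sub>E \<rho>)"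
    unfolding discrepancy_def using int assms(2-4) space_of_prob_algebra[OF vd]
    by (intro integral_mono) (auto intro!: D_TV_triangle simp: space_pair_measure)
  also have "\<dots> = discrepancy M \<pi>\<^sub>E \<rho> \<pi>\<^sub>2 \<pi>\<^sub>1 + discrepancy M \<pi>\<^sub>E \<rho> \<pi>\<^sub>2 \<pi>\<^sub>3"
    unfolding discrepancy_def using int assms(2-4) by (intro Bochner_Integration.integral_add) auto
  finally show ?thesis .
qed

end

text \<open>The quantifier over \<open>H\<close> stands inside the event, so on one and the same
  event the bound covers a policy chosen after seeing the samples, in particular a minimizer of the
  empirical loss.\<close>

theorem theorem3p1:
  fixes M :: "('s, 'a, 'g) gamdp"
    and PS PT :: "('s \<times> 'g) measure"
    and H :: "('s, 'a, 'g) policy set"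
    and \<pi>\<^sub>E \<pi>\<^sub>E' :: "('s, 'a, 'g) policy"
    and m :: nat and \<delta> :: real
  assumes "is_gamdp M"
    and "PS \<in> space (prob_algebra (inputs M))"
    and "PT \<in> space (prob_algebra (inputs M))"
    and "is_policy M \<pi>\<^sub>E"
    and "is_policy M \<pi>\<^sub>E'"
    and "finite H" and "\<And>\<pi>. \<pi> \<in> H \<Longrightarrow> is_policy M \<pi>"
    and "m \<ge> 1" and "0 < \<delta>" and "\<delta> < 1"
  shows "\<P>(z in sample_space M \<pi>\<^sub>E PS m. \<forall>\<pi>\<in>H.
           SubOpt M PT \<pi>\<^sub>E \<pi> \<le> 2 * R_max M / (1 - discount M)^2 *
             (emp_discrepancy M m z \<pi>\<^sub>E' \<pi> + discrepancy M \<pi>\<^sub>E PS \<pi>\<^sub>E' \<pi>\<^sub>E + d1 M PT PS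
              + sqrt ((ln (2 * real (card H)) + ln (1 / \<delta>)) / (2 * real m)))) \<ge> 1 - \<delta>"
proof -
  interpret gamdp M by unfold_locales fact
  define N where "N = visit_dist M \<pi>\<^sub>E PS"
  define h where "h = (\<lambda>\<pi> (s, g). D_TV M \<pi>\<^sub>E' \<pi> s g)"
  define c where "c = 2 * R / (1 - \<gamma>)^2"
  define \<epsilon> where "\<epsilon> = sqrt ((ln (2 * real (card H)) + ln (1 / \<delta>)) / (2 * real m))"
  have N: "N \<in> space (prob_algebra (inputs M))" unfolding N_def by (intro visit_dist_in_space assms)
  then have setsN: "sets N = sets (inputs M)" and "prob_space N" by (auto simp: space_prob_algebra)
  interpret N: prob_space N by fact
  interpret Z: prob_space "\<Pi>\<^sub>M i\<in>{..<m}. N" by (intro prob_space_PiM N.prob_space_axioms)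
  have h: "h \<pi> \<in> borel_measurable N" if "\<pi> \<in> H" for \<pi>
    unfolding h_def measurable_cong_sets[OF setsN refl] by (intro D_TV_measurable assms that)
  have h01: "h \<pi> x \<in> {0..1}" if "\<pi> \<in> H" "x \<in> space N" for \<pi> x
    using D_TV_bounds[OF assms(5) assms(7)[OF that(1)]] that(2) space_of_prob_algebra[OF N]
    by (auto simp: h_def space_pair_measure)
  have emp: "(\<Sum>i<m. h \<pi> (z i)) / real m = emp_discrepancy M m z \<pi>\<^sub>E' \<pi>" for z \<pi>
    by (simp add: emp_discrepancy_def h_def case_prod_beta')
  have exph: "N.expectation (h \<pi>) = discrepancy M \<pi>\<^sub>E PS \<pi>\<^sub>E' \<pi>" for \<pi>
    by (simp add: discrepancy_def N_def h_def)
  have PTs: "prob_space PT" "prob_space PS" using assms(2,3) by (auto simp: space_prob_algebra)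
  interpret PT: prob_space PT by fact
  have c: "0 \<le> c"
  proof -
    obtain s g where sg: "s \<in> space \<S>" "g \<in> space \<G>"
      using PT.not_empty space_of_prob_algebra[OF assms(3)] by (auto simp: space_pair_measure)
    interpret E: gamdp_policy M \<pi>\<^sub>E g using assms(4) sg by unfold_locales
    have "0 \<le> R" using E.abs_mean_reward_le[OF sg(1)] by linarith
    then show ?thesis by (simp add: c_def)
  qed
  let ?bound = "\<lambda>z \<pi>. c * (emp_discrepancy M m z \<pi>\<^sub>E' \<pi> + discrepancy M \<pi>\<^sub>E PS \<pi>\<^sub>E' \<pi>\<^sub>E + d1 M PT PS + \<epsilon>)"
  have "1 - \<delta> \<le> \<P>(z in (\<Pi>\<^sub>M i\<in>{..<m}. N). \<forall>\<pi>\<in>H.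
      discrepancy M \<pi>\<^sub>E PS \<pi>\<^sub>E' \<pi> \<le> emp_discrepancy M m z \<pi>\<^sub>E' \<pi> + \<epsilon>)"
    using N.uniform_Hoeffding[of H h m \<delta>, OF assms(6) h h01 assms(8-10)] unfolding emp exph \<epsilon>_def .
  also have "\<dots> \<le> \<P>(z in (\<Pi>\<^sub>M i\<in>{..<m}. N). \<forall>\<pi>\<in>H. SubOpt M PT \<pi>\<^sub>E \<pi> \<le> ?bound z \<pi>)"
  proof (rule Z.finite_measure_mono)
    \<comment> \<open>The event is first written with \<open>h\<close>, whose measurability on the
      sample law is known, and then folded back to \<open>emp_discrepancy\<close>.\<close>
    have "{z \<in> space (\<Pi>\<^sub>M i\<in>{..<m}. N). \<forall>\<pi>\<in>H. SubOpt M PT \<pi>\<^sub>E \<pi> \<le>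
        c * ((\<Sum>i<m. h \<pi> (z i)) / real m + discrepancy M \<pi>\<^sub>E PS \<pi>\<^sub>E' \<pi>\<^sub>E + d1 M PT PS + \<epsilon>)}
        \<in> sets (\<Pi>\<^sub>M i\<in>{..<m}. N)"
      using h assms(6) by measurable
    then show "{z \<in> space (\<Pi>\<^sub>M i\<in>{..<m}. N). \<forall>\<pi>\<in>H. SubOpt M PT \<pi>\<^sub>E \<pi> \<le> ?bound z \<pi>}
        \<in> sets (\<Pi>\<^sub>M i\<in>{..<m}. N)"
      unfolding emp .
    have "SubOpt M PT \<pi>\<^sub>E \<pi> \<le> ?bound z \<pi>"
      if "\<pi> \<in> H" and le: "discrepancy M \<pi>\<^sub>E PS \<pi>\<^sub>E' \<pi> \<le> emp_discrepancy M m z \<pi>\<^sub>E' \<pi> + \<epsilon>" for z \<pi>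
    proof -
      have \<pi>: "is_policy M \<pi>" using assms(7) that(1) .
      have "SubOpt M PT \<pi>\<^sub>E \<pi> \<le> c * (discrepancy M \<pi>\<^sub>E PS \<pi>\<^sub>E \<pi> + sup_diff (inputs M) PT PS)"
        unfolding c_def by (rule SubOpt_le[OF assms(4) \<pi> assms(2,3)])
      \<comment> \<open>The triangle inequality passes from \<open>\<pi>\<^sub>E\<close> through
        \<open>\<pi>\<^sub>E'\<close> to \<open>\<pi>\<close>; the leg to \<open>\<pi>\<close> is
        replaced by its empirical version, the other leg stays as the surrogate's own error.
        Nonnegativity of \<open>sup_diff\<close> bounds it by its double \<open>d1\<close>.\<close>
      also have "\<dots> \<le> ?bound z \<pi>"
        using discrepancy_triangle[OF assms(4) assms(4) assms(5) \<pi> assms(2)] le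
          sup_diff_nonneg[OF PTs, of "inputs M"]
        by (intro mult_left_mono c) (simp add: d1_def)
      finally show ?thesis .
    qed
    then show "{z \<in> space (\<Pi>\<^sub>M i\<in>{..<m}. N). \<forall>\<pi>\<in>H.
        discrepancy M \<pi>\<^sub>E PS \<pi>\<^sub>E' \<pi> \<le> emp_discrepancy M m z \<pi>\<^sub>E' \<pi> + \<epsilon>}
      \<subseteq> {z \<in> space (\<Pi>\<^sub>M i\<in>{..<m}. N). \<forall>\<pi>\<in>H. SubOpt M PT \<pi>\<^sub>E \<pi> \<le> ?bound z \<pi>}"
      by blast
  qed
  finally show ?thesis
    by (simp add: sample_space_def N_def c_def \<epsilon>_def)
qed

end
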